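(* Let $\mathbb{G}$ be a quantum permutation group and let $\mathbb{S}\subseteq \mathcal{S}(C(\mathbb{G}))$ be a Pal set. Then $\mathbb{S}$ contains a unique $\mathbb{S}$-invariant state, i.e. there is a unique $\phi_{\mathbb{S}}\in\mathbb{S}$ such that for all $\varphi\in\mathbb{S}$: $$\phi_{\mathbb{S}}\star \varphi=\phi_{\mathbb{S}}=\varphi\star\phi_{\mathbb{S}}.$$
   Context: A compact quantum group $\mathbb{G}$ is given by a unital $\mathrm{C}^*$-algebra $C(\mathbb{G})$ with a coassociative unital $*$-homomorphism $\Delta:C(\mathbb{G})\to C(\mathbb{G})\otimes C(\mathbb{G})$ (minimal tensor product) such that $\Delta(C(\mathbb{G}))(\mathds{1}\otimes C(\mathbb{G}))$ and $\Delta(C(\mathbb{G}))(C(\mathbb{G})\otimes \mathds{1})$ are dense (linear span) in $C(\mathbb{G})\otimes C(\mathbb{G})$. A magic unitary is an $N\times N$ matrix $u=(u_{ij})$ of projections in a unital $\mathrm{C}^*$-algebra whose rows and columns each sum to the unit. A quantum permutation group is a compact quantum group $\mathbb{G}$ together with a magic unitary $u\in M_N(C(\mathbb{G}))$ whose entries generate $C(\mathbb{G})$ as a $\mathrm{C}^*$-algebra and satisfy $\Delta(u_{ij})=\sum_{k}u_{ik}\otimes u_{kj}$. $C(\mathbb{G})$ is always assumed universal, i.e. it is the universal (maximal) $\mathrm{C}^*$-completion of the dense Hopf $*$-algebra $\mathcal{O}(\mathbb{G})$ generated by the $u_{ij}$. $\mathcal{S}(C(\mathbb{G}))$ denotes the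 state space of $C(\mathbb{G})$. The convolution of states is $\varphi_1\star\varphi_2:=(\varphi_1\otimes\varphi_2)\Delta$. A Pal set is a non-empty, convex, weak-* closed subset $\mathbb{S}\subseteq\mathcal{S}(C(\mathbb{G}))$ that is closed under convolution: $\varphi,\rho\in\mathbb{S}\Rightarrow\varphi\star\rho\in\mathbb{S}$. *)

theory Defs
  imports "HOL-Analysis.Analysis"
begin

section \<open>Unital C*-algebras\<close>

text \<open>
  The norm, completeness, submultiplicativity and the unit come from the real classes of
  HOL-Analysis. The class \<^class>\<open>real_normed_algebra_1\<close> excludes only the zero algebra, which has
  no states. The complex structure is required to extend the real one.
\<close>

class cstar_algebra = real_normed_algebra_1 + banach +
  fixes scaleC :: "complex \<Rightarrow> 'a \<Rightarrow> 'a" (infixr \<open>*\<^sub>C\<close> 75)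
    and star :: "'a \<Rightarrow> 'a"
  assumes scaleC_of_real: "complex_of_real r *\<^sub>C x = r *\<^sub>R x"
    and scaleC_add_right: "c *\<^sub>C (x + y) = c *\<^sub>C x + c *\<^sub>C y"
    and scaleC_add_left: "(c + d) *\<^sub>C x = c *\<^sub>C x + d *\<^sub>C x"
    and scaleC_scaleC: "c *\<^sub>C d *\<^sub>C x = (c * d) *\<^sub>C x"
    and mult_scaleC_left: "(c *\<^sub>C x) * y = c *\<^sub>C (x * y)"
    and mult_scaleC_right: "x * (c *\<^sub>C y) = c *\<^sub>C (x * y)"
    and norm_scaleC: "norm (c *\<^sub>C x) = cmod c * norm x"
    and star_star: "star (star x) = x"
    and star_add: "star (x + y) = star x + star y"
    and star_scaleC: "star (c *\<^sub>C x) = cnj c *\<^sub>C star x"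
    and star_mult: "star (x * y) = star y * star x"
    and cstar_identity: "norm (star x * x) = (norm x)\<^sup>2"

definition clinear :: "('a::cstar_algebra \<Rightarrow> 'b::cstar_algebra) \<Rightarrow> bool" where
  "clinear f \<longleftrightarrow> (\<forall>x y. f (x + y) = f x + f y) \<and> (\<forall>c x. f (c *\<^sub>C x) = c *\<^sub>C f x)"

definition star_hom :: "('a::cstar_algebra \<Rightarrow> 'b::cstar_algebra) \<Rightarrow> bool" where
  "star_hom f \<longleftrightarrow> clinear f \<and> (\<forall>x y. f (x * y) = f x * f y) \<and>
     (\<forall>x. f (star x) = star (f x)) \<and> f 1 = 1"

definition projection :: "'a::cstar_algebra \<Rightarrow> bool" where
  "projection p \<longleftrightarrow> star p = p \<and> p * p = p"

definition star_subalgebra :: "'a::cstar_algebra set \<Rightarrow> bool" where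
  "star_subalgebra B \<longleftrightarrow> 0 \<in> B \<and> (\<forall>x\<in>B. \<forall>y\<in>B. x + y \<in> B \<and> x * y \<in> B) \<and>
     (\<forall>c. \<forall>x\<in>B. c *\<^sub>C x \<in> B) \<and> (\<forall>x\<in>B. star x \<in> B)"

definition cstar_seminorm_on :: "'a::cstar_algebra set \<Rightarrow> ('a \<Rightarrow> real) \<Rightarrow> bool" where
  "cstar_seminorm_on B p \<longleftrightarrow>
     (\<forall>x\<in>B. \<forall>y\<in>B. p (x + y) \<le> p x + p y \<and> p (x * y) \<le> p x * p y) \<and>
     (\<forall>c. \<forall>x\<in>B. p (c *\<^sub>C x) = cmod c * p x) \<and>
     (\<forall>x\<in>B. p (star x * x) = (p x)\<^sup>2)"

text \<open>
  An algebra is the universal C*-completion of a *-subalgebra \<open>B\<close> if \<open>B\<close> is dense and the norm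
  restricts to the largest C*-seminorm on \<open>B\<close> (the norm itself is one).
\<close>

definition universal_completion_of :: "'a::cstar_algebra set \<Rightarrow> bool" where
  "universal_completion_of B \<longleftrightarrow> star_subalgebra B \<and> closure B = UNIV \<and>
     (\<forall>p. cstar_seminorm_on B p \<longrightarrow> (\<forall>x\<in>B. p x \<le> norm x))"


section \<open>States\<close>

text \<open>
  Bounded functionals are elements of the type \<^typ>\<open>'a \<Rightarrow>\<^sub>L complex\<close>, which contains all bounded
  real-linear maps, so that complex linearity is imposed separately.
\<close>

definition state :: "('a::cstar_algebra \<Rightarrow>\<^sub>L complex) \<Rightarrow> bool" where
  "state \<phi> \<longleftrightarrow> (\<forall>c x. \<phi> (c *\<^sub>C x) = c * \<phi> x) \<and> (\<forall>x. \<phi> (star x * x) \<in> \<real>\<^sub>\<ge>\<^sub>0) \<and> norm \<phi> = 1"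

text \<open>
  On functionals, the strong operator topology is the topology of pointwise convergence, i.e. the
  weak-* topology.
\<close>

abbreviation weak_star_topology :: "('a::cstar_algebra \<Rightarrow>\<^sub>L complex) topology" where
  "weak_star_topology \<equiv> strong_operator_topology"


section \<open>Minimal tensor products\<close>

text \<open>
  A list of pairs \<open>[(a\<^sub>1, b\<^sub>1), \<dots>, (a\<^sub>n, b\<^sub>n)]\<close> represents the element
  \<open>a\<^sub>1 \<otimes> b\<^sub>1 + \<dots> + a\<^sub>n \<otimes> b\<^sub>n\<close> of the algebraic tensor product. The following operations are the
  product, the involution, and the functional \<open>\<phi> \<otimes> \<psi>\<close> on representatives.
\<close>

definition alg_mult :: "('a::cstar_algebra \<times> 'b::cstar_algebra) list \<Rightarrow> ('a \<times> 'b) list \<Rightarrow> ('a \<times> 'b) list"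
  where "alg_mult xs ys = [(a * c, b * d). (a, b) \<leftarrow> xs, (c, d) \<leftarrow> ys]"

definition alg_star :: "('a::cstar_algebra \<times> 'b::cstar_algebra) list \<Rightarrow> ('a \<times> 'b) list" where
  "alg_star xs = [(star a, star b). (a, b) \<leftarrow> xs]"

definition alg_functional ::
    "('a::cstar_algebra \<Rightarrow>\<^sub>L complex) \<Rightarrow> ('b::cstar_algebra \<Rightarrow>\<^sub>L complex) \<Rightarrow> ('a \<times> 'b) list \<Rightarrow> complex"
  where "alg_functional \<phi> \<psi> xs = (\<Sum>(a, b)\<leftarrow>xs. \<phi> a * \<psi> b)"

text \<open>
  The spatial norm of \<open>x\<close> is the supremum of \<open>\<parallel>(\<pi>\<^sub>\<phi> \<otimes> \<pi>\<^sub>\<psi>)(x)\<parallel>\<close> over all states \<open>\<phi>\<close>, \<open>\<psi>\<close>, with \<open>\<pi>\<^sub>\<phi>\<close>, \<open>\<pi>\<^sub>\<psi>\<close>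
  their GNS representations. On the Hilbert space \<open>H\<^sub>\<phi> \<otimes> H\<^sub>\<psi>\<close> the classes of algebraic tensors \<open>y\<close> are
  dense, with \<open>\<parallel>y\<parallel>\<^sup>2 = (\<phi> \<otimes> \<psi>)(y\<^sup>* y)\<close> and \<open>\<parallel>(\<pi>\<^sub>\<phi> \<otimes> \<pi>\<^sub>\<psi>)(x) y\<parallel>\<^sup>2 = (\<phi> \<otimes> \<psi>)((x y)\<^sup>* x y)\<close>.
\<close>

definition spatial_norm :: "('a::cstar_algebra \<times> 'b::cstar_algebra) list \<Rightarrow> real" where
  "spatial_norm xs = Sup {sqrt (Re (alg_functional \<phi> \<psi>
        (alg_mult (alg_star (alg_mult xs ys)) (alg_mult xs ys)))) | \<phi> \<psi> ys.
      state \<phi> \<and> state \<psi> \<and> alg_functional \<phi> \<psi> (alg_mult (alg_star ys) ys) = 1}"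

text \<open>
  The predicate below states that the type \<open>'c\<close> with elementary tensors \<open>t a b\<close> is the minimal
  tensor product of \<open>'a\<close> and \<open>'b\<close>, i.e. the completion of their algebraic tensor product in the
  spatial norm; this determines \<open>'c\<close> and \<open>t\<close> up to isomorphism. Injectivity on the algebraic tensor
  product follows from the norm condition. The set of elementary tensors is stable under complex
  scalars, so its real span is its complex span.
\<close>

definition minimal_tensor_product ::
    "('a::cstar_algebra \<Rightarrow> 'b::cstar_algebra \<Rightarrow> 'c::cstar_algebra) \<Rightarrow> bool" where
  "minimal_tensor_product t \<longleftrightarrow>
     (\<forall>b. clinear (\<lambda>a. t a b)) \<and> (\<forall>a. clinear (t a)) \<and>
     (\<forall>a b c d. t a b * t c d = t (a * c) (b * d)) \<and>
     (\<forall>a b. star (t a b) = t (star a) (star b)) \<and>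
     t 1 1 = 1 \<and>
     (\<forall>xs. norm (\<Sum>(a, b)\<leftarrow>xs. t a b) = spatial_norm xs) \<and>
     closure (span {t a b | a b. True}) = UNIV"

text \<open>
  The functional \<open>\<phi> \<otimes> \<psi>\<close> and the homomorphism \<open>f \<otimes> g\<close>, for states \<open>\<phi>\<close>, \<open>\<psi>\<close> and unital
  *-homomorphisms \<open>f\<close>, \<open>g\<close>. Both are unique because they are continuous and the elementary tensors
  span a dense subspace; they exist because the spatial norm is functorial.
\<close>

definition tensor_functional :: "('a::cstar_algebra \<Rightarrow> 'b::cstar_algebra \<Rightarrow> 'c::cstar_algebra) \<Rightarrow>
    ('a \<Rightarrow>\<^sub>L complex) \<Rightarrow> ('b \<Rightarrow>\<^sub>L complex) \<Rightarrow> ('c \<Rightarrow>\<^sub>L complex)" where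
  "tensor_functional t \<phi> \<psi> = (THE F :: 'c \<Rightarrow>\<^sub>L complex. \<forall>a b. F (t a b) = \<phi> a * \<psi> b)"

definition tensor_hom :: "('a::cstar_algebra \<Rightarrow> 'b::cstar_algebra \<Rightarrow> 'c::cstar_algebra) \<Rightarrow>
    ('d::cstar_algebra \<Rightarrow> 'e::cstar_algebra \<Rightarrow> 'f::cstar_algebra) \<Rightarrow>
    ('a \<Rightarrow> 'd) \<Rightarrow> ('b \<Rightarrow> 'e) \<Rightarrow> 'c \<Rightarrow> 'f" where
  "tensor_hom t s f g =
     (THE F. star_hom F \<and> continuous_on UNIV F \<and> (\<forall>a b. F (t a b) = s (f a) (g b)))"


section \<open>Quantum permutation groups\<close>

text \<open>
  Here \<open>'a\<close> is \<open>C(G)\<close>, \<open>'b\<close> is \<open>C(G) \<otimes> C(G)\<close>, and \<open>'c\<close> is the threefold tensor product, presented both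
  as \<open>(C(G) \<otimes> C(G)) \<otimes> C(G)\<close> by \<open>tenl\<close> and as \<open>C(G) \<otimes> (C(G) \<otimes> C(G))\<close> by \<open>tenr\<close>; the two are identified
  through the canonical associator. In the density conditions \<open>\<Delta> a\<close> can absorb complex
  scalars, so the real span is again the complex one.
\<close>

locale compact_quantum_group =
  fixes t :: "'a::cstar_algebra \<Rightarrow> 'a \<Rightarrow> 'b::cstar_algebra"
    and tenl :: "'b \<Rightarrow> 'a \<Rightarrow> 'c::cstar_algebra"
    and tenr :: "'a \<Rightarrow> 'b \<Rightarrow> 'c"
    and \<Delta> :: "'a \<Rightarrow> 'b"
  assumes tensor: "minimal_tensor_product t"
    and tensor_left: "minimal_tensor_product tenl"
    and tensor_right: "minimal_tensor_product tenr"
    and associator: "tenl (t a b) c = tenr a (t b c)"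
    and comult_hom: "star_hom \<Delta>"
    and coassociative: "tensor_hom t tenl \<Delta> id (\<Delta> x) = tensor_hom t tenr id \<Delta> (\<Delta> x)"
    and dense_right: "closure (span {\<Delta> a * t 1 b | a b. True}) = UNIV"
    and dense_left: "closure (span {\<Delta> a * t b 1 | a b. True}) = UNIV"

definition magic_unitary :: "nat \<Rightarrow> (nat \<Rightarrow> nat \<Rightarrow> 'a::cstar_algebra) \<Rightarrow> bool" where
  "magic_unitary N u \<longleftrightarrow> (\<forall>i<N. \<forall>j<N. projection (u i j)) \<and>
     (\<forall>i<N. (\<Sum>j<N. u i j) = 1) \<and> (\<forall>j<N. (\<Sum>i<N. u i j) = 1)"

definition coefficient_algebra :: "nat \<Rightarrow> (nat \<Rightarrow> nat \<Rightarrow> 'a::cstar_algebra) \<Rightarrow> 'a set" where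
  "coefficient_algebra N u = star_subalgebra hull {u i j | i j. i < N \<and> j < N}"

text \<open>
  The density contained in \<^const>\<open>universal_completion_of\<close> says that the entries of \<open>u\<close> generate
  \<open>C(G)\<close> as a C*-algebra. This forces \<open>N \<ge> 1\<close>, and then the unit, being a row sum, lies in the
  coefficient algebra.
\<close>

locale quantum_permutation_group = compact_quantum_group t tenl tenr \<Delta>
  for t :: "'a::cstar_algebra \<Rightarrow> 'a \<Rightarrow> 'b::cstar_algebra"
    and tenl :: "'b \<Rightarrow> 'a \<Rightarrow> 'c::cstar_algebra"
    and tenr :: "'a \<Rightarrow> 'b \<Rightarrow> 'c"
    and \<Delta> :: "'a \<Rightarrow> 'b" +
  fixes N :: nat
    and u :: "nat \<Rightarrow> nat \<Rightarrow> 'a"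
  assumes magic: "magic_unitary N u"
    and comult_entry: "i < N \<Longrightarrow> j < N \<Longrightarrow> \<Delta> (u i j) = (\<Sum>k<N. t (u i k) (u k j))"
    and universal: "universal_completion_of (coefficient_algebra N u)"


section \<open>Convolution and Pal sets\<close>

definition convolution :: "('a::cstar_algebra \<Rightarrow> 'a \<Rightarrow> 'b::cstar_algebra) \<Rightarrow> ('a \<Rightarrow> 'b) \<Rightarrow>
    ('a \<Rightarrow>\<^sub>L complex) \<Rightarrow> ('a \<Rightarrow>\<^sub>L complex) \<Rightarrow> ('a \<Rightarrow>\<^sub>L complex)" where
  "convolution t \<Delta> \<phi> \<psi> = Blinfun (\<lambda>x. tensor_functional t \<phi> \<psi> (\<Delta> x))"

definition pal_set :: "('a::cstar_algebra \<Rightarrow> 'a \<Rightarrow> 'b::cstar_algebra) \<Rightarrow> ('a \<Rightarrow> 'b) \<Rightarrow>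
    ('a \<Rightarrow>\<^sub>L complex) set \<Rightarrow> bool" where
  "pal_set t \<Delta> S \<longleftrightarrow> S \<subseteq> Collect state \<and> S \<noteq> {} \<and> convex S \<and> closedin weak_star_topology S \<and>
     (\<forall>\<phi>\<in>S. \<forall>\<rho>\<in>S. convolution t \<Delta> \<phi> \<rho> \<in> S)"

end

theory Submission
  imports Defs
begin

text \<open>
  The values of a state on the words of length \<open>k\<close> in the entries of \<open>u\<close> form a matrix of size \<open>N\<^sup>k\<close>,
  which is a contraction because the \<open>k\<close>-th tensor power of \<open>u\<close> is unitary, and convolution of states
  is multiplication of these matrices. Convolving with a state therefore does not increase their
  Hilbert-Schmidt norms, which we call energies. A sequence in \<open>S\<close> that asymptotically minimises the
  energy for every \<open>k\<close> converges on all words by the parallelogram law, hence weak-*, to some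
  \<open>\<phi> \<in> S\<close>. Convolving it with \<open>\<psi> \<in> S\<close> gives another such sequence, which by the parallelogram law
  has the same limit, so that \<open>\<psi> \<star> \<phi> = \<phi> = \<phi> \<star> \<psi>\<close>.
\<close>

section \<open>Positive functionals\<close>

text \<open>Minimising energies avoids compactness of the state space: as \<open>S\<close> is
  convex, the parallelogram law alone makes a minimising sequence Cauchy on words. One sequence has
  to serve all word lengths, which is possible because the energy of a convolution is bounded by
  that of either factor. Much of the work lies in showing that convolution really is multiplication
  of matrices. \<open>tensor_functional\<close> is a definite description and
  \<open>spatial_norm\<close> a supremum, so \<phi> \<otimes> \<psi> must first be shown to be well
  defined and bounded on algebraic tensors; this rests on the Schur product theorem. The C*-algebra
  theory behind it comes from one square root, that of \<open>1 - h\<close> with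
  \<open>norm h < 1\<close>, which bounds a positive functional by its value at 1. Positivity is
  only tested on squares through functionals, so the orthogonality of the projections in a magic
  unitary is also stated after applying a functional.\<close>

lemma scaleC_one [simp]: "1 *\<^sub>C x = (x::'a::cstar_algebra)"
  using scaleC_of_real[of 1 x] by simp

lemma scaleC_minus1: "(- 1) *\<^sub>C x = - (x::'a::cstar_algebra)"
  using scaleC_of_real[of "-1" x] by simp

lemma scaleC_zero [simp]: "c *\<^sub>C (0::'a::cstar_algebra) = 0" "0 *\<^sub>C x = (0::'a::cstar_algebra)"
  using scaleC_add_right[of c 0 "0::'a"] scaleC_add_left[of 0 0 x] by auto

lemma scaleR_scaleC: "r *\<^sub>R x = complex_of_real r *\<^sub>C (x::'a::cstar_algebra)"
  by (simp add: scaleC_of_real)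

lemma star_zero [simp]: "star (0::'a::cstar_algebra) = 0"
  using star_add[of 0 "0::'a"] by simp

lemma star_one [simp]: "star (1::'a::cstar_algebra) = 1"
  by (metis mult.left_neutral mult.right_neutral star_mult star_star)

lemma star_scaleR: "star (r *\<^sub>R x) = r *\<^sub>R star (x::'a::cstar_algebra)"
  by (simp add: scaleR_scaleC star_scaleC)

lemma star_minus: "star (- x) = - star (x::'a::cstar_algebra)"
  using star_scaleR[of "-1" x] by simp

lemma star_sum: "star (\<Sum>i\<in>I. x i) = (\<Sum>i\<in>I. star (x i :: 'a::cstar_algebra))"
  by (induction I rule: infinite_finite_induct) (auto simp: star_add)

lemma star_power: "star (x ^ n) = star (x::'a::cstar_algebra) ^ n"
  by (induction n) (auto simp: star_mult power_commutes)

lemma norm_star: "norm (star x) = norm (x::'a::cstar_algebra)"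
proof -
  have "norm y \<le> norm (star y)" for y :: 'a
  proof (cases "y = 0")
    case False
    have "norm y * norm y \<le> norm (star y) * norm y"
      using norm_mult_ineq[of "star y" y] unfolding cstar_identity power2_eq_square .
    then show ?thesis using False mult_le_cancel_right_pos[of "norm y"] by simp
  qed auto
  from this[of x] this[of "star x"] show ?thesis by (simp add: star_star)
qed

lemma bounded_linear_star: "bounded_linear (star :: 'a::cstar_algebra \<Rightarrow> 'a)"
  by (rule bounded_linear_intro[of _ 1]) (auto simp: star_add star_scaleR norm_star)

text \<open>The root is the binomial series of exponent 1/2 in \<open>- h\<close>. It converges
  absolutely, its Cauchy square is evaluated by the Vandermonde identity, and it is selfadjoint
  because its coefficients are real.\<close>

lemma sqrt_one_minus:
  fixes h :: "'a::cstar_algebra"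
  assumes "star h = h" "norm h < 1"
  obtains y where "star y = y" "y * y = 1 - h"
proof -
  define a where "a = (\<lambda>n. ((1/2::real) gchoose n) *\<^sub>R (- h) ^ n)"
  have "summable (\<lambda>n. norm (((1/2::real) gchoose n) * norm h ^ n))"
  proof (rule abs_summable_in_conv_radius)
    have "1 \<le> conv_radius (\<lambda>n. (1/2::real) gchoose n)"
      unfolding conv_radius_gchoose by simp
    then show "ereal (norm (norm h)) < conv_radius (\<lambda>n. (1/2::real) gchoose n)"
      by (rule less_le_trans[rotated]) (use assms in simp)
  qed
  then have sm: "summable (\<lambda>n. norm (a n))"
    by (rule summable_comparison_test'[where N=0])
       (use norm_power_ineq[of "- h"] in \<open>auto simp: a_def abs_mult intro!: mult_left_mono\<close>)
  have "(\<Sum>i\<le>k. a i * a (k - i)) = ((1::real) gchoose k) *\<^sub>R (- h) ^ k" for k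
  proof -
    have "(\<Sum>i\<le>k. a i * a (k - i)) =
        (\<Sum>i\<le>k. ((1/2 gchoose i) * (1/2 gchoose (k - i)) :: real) *\<^sub>R (- h) ^ k)"
      by (rule sum.cong) (auto simp: a_def power_add[symmetric])
    also have "\<dots> = (\<Sum>i\<le>k. ((1/2 gchoose i) * (1/2 gchoose (k - i)) :: real)) *\<^sub>R (- h) ^ k"
      by (simp add: scaleR_sum_left)
    also have "(\<Sum>i\<le>k. ((1/2 gchoose i) * (1/2 gchoose (k - i)) :: real)) = 1 gchoose k"
      using gbinomial_Vandermonde[of "1/2::real" "1/2" k] by (simp add: atLeast0AtMost)
    finally show ?thesis .
  qed
  with Cauchy_product_sums[OF sm sm]
  have 1: "(\<lambda>k. ((1::real) gchoose k) *\<^sub>R (- h) ^ k) sums (suminf a * suminf a)"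
    by simp
  \<comment> \<open>The squared series has exponent 1/2 + 1/2 = 1 and so stops after the linear
    term.\<close>
  have "((1::real) gchoose k) = 0" if "k \<notin> {0,1}" for k
  proof -
    have "1 choose k = 0" using that by (intro binomial_eq_0) auto
    then show ?thesis using binomial_gbinomial[of 1 k, where 'a=real] by (metis of_nat_0 of_nat_1)
  qed
  then have "(\<lambda>k. ((1::real) gchoose k) *\<^sub>R (- h) ^ k) sums (\<Sum>k\<in>{0,1}. ((1::real) gchoose k) *\<^sub>R (- h) ^ k)"
    by (intro sums_finite) auto
  from sums_unique2[OF 1 this] have 2: "suminf a * suminf a = 1 - h"
    by simp
  have "star (suminf a) = suminf (\<lambda>n. star (a n))"
    by (rule bounded_linear.suminf[OF bounded_linear_star]) (rule summable_norm_cancel[OF sm])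
  also have "(\<lambda>n. star (a n)) = a"
    by (auto simp: a_def star_scaleR star_power star_minus assms)
  finally show ?thesis using that 2 by blast
qed

text \<open>Stated for plain functions and without normalisation: it is applied to functions whose
  boundedness is not known beforehand, and boundedness is then a consequence of positivity.\<close>

definition positive_functional :: "('a::cstar_algebra \<Rightarrow> complex) \<Rightarrow> bool" where
  "positive_functional f \<longleftrightarrow> (\<forall>x y. f (x + y) = f x + f y) \<and> (\<forall>c x. f (c *\<^sub>C x) = c * f x) \<and>
     (\<forall>x. f (star x * x) \<in> \<real>\<^sub>\<ge>\<^sub>0)"

text \<open>The discriminant criterion over the complex numbers. It yields both the Cauchy-Schwarz
  inequality and the positivity of Schur complements.\<close>

lemma quadratic_nonneg_imp:
  fixes c :: complex
  assumes "\<And>z. 0 \<le> a + 2 * Re (z * c) + (cmod z)\<^sup>2 * b" "0 \<le> b"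
  shows "(cmod c)\<^sup>2 \<le> a * b"
proof -
  have cc: "cnj c * c = complex_of_real ((cmod c)\<^sup>2)"
    using complex_norm_square[of c] by (simp add: mult.commute)
  show ?thesis
  proof (cases "b = 0")
    case True
    have "c = 0"
    proof (rule ccontr)
      assume "c \<noteq> 0"
      \<comment> \<open>Scaled so that the cross term becomes
        \<open>- 2 * (\<bar>a\<bar> + 1)\<close>, which outweighs \<open>a\<close>.\<close>
      define s where "s = (\<bar>a\<bar> + 1) / (cmod c)\<^sup>2"
      have "of_real (- s) * cnj c * c = complex_of_real (- s * (cmod c)\<^sup>2)"
        by (simp add: cc mult.assoc)
      also have "- s * (cmod c)\<^sup>2 = - (\<bar>a\<bar> + 1)"
        using \<open>c \<noteq> 0\<close> by (simp add: s_def)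
      finally have "Re (of_real (- s) * cnj c * c) = - (\<bar>a\<bar> + 1)"
        by simp
      with assms(1)[of "of_real (- s) * cnj c"] True show False by simp
    qed
    then show ?thesis using True by simp
  next
    case False
    \<comment> \<open>The point \<open>- cnj c / b\<close> minimises the quadratic.\<close>
    have "Re (- cnj c / b * c) = - (cmod c)\<^sup>2 / b"
      by (simp add: cc flip: of_real_power)
    moreover have "(cmod (- cnj c / b))\<^sup>2 * b = (cmod c)\<^sup>2 / b"
      using False assms(2) by (simp add: norm_divide power_divide power2_eq_square)
    ultimately have "0 \<le> a - (cmod c)\<^sup>2 / b"
      using assms(1)[of "- cnj c / b"] by linarith
    then show ?thesis using False assms(2) by (simp add: field_simps)
  qed
qed

context
  fixes f :: "'a::cstar_algebra \<Rightarrow> complex"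
  assumes f: "positive_functional f"
begin

lemma positive_functional_simps:
  "f (x + y) = f x + f y" "f (c *\<^sub>C x) = c * f x" "f 0 = 0" "f (- x) = - f x" "f (x - y) = f x - f y"
  "f (r *\<^sub>R x) = r *\<^sub>R f x"
proof -
  have add: "f (x + y) = f x + f y" for x y
    using f by (auto simp: positive_functional_def)
  have sc: "f (c *\<^sub>C x) = c * f x" for c x
    using f by (auto simp: positive_functional_def)
  show m: "f (- x) = - f x" for x using sc[of "-1" x] by (simp add: scaleC_minus1)
  show "f (x - y) = f x - f y" using add[of x "-y"] m by simp
  show "f (r *\<^sub>R x) = r *\<^sub>R f x" by (simp add: scaleR_scaleC sc scaleR_conv_of_real)
  show "f 0 = 0" using sc[of 0 0] by simp
qed (use f in \<open>auto simp: positive_functional_def\<close>)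

lemma positive_functional_sum: "f (\<Sum>i\<in>I. x i) = (\<Sum>i\<in>I. f (x i))"
  by (induction I rule: infinite_finite_induct) (auto simp: positive_functional_simps)

lemma positive_functional_nonneg: "f (star x * x) \<in> \<real>\<^sub>\<ge>\<^sub>0" "0 \<le> Re (f (star x * x))" "Im (f (star x * x)) = 0"
  using f by (auto simp: positive_functional_def complex_nonneg_Reals_iff)

text \<open>Polarisation: the values at squares of \<open>x + c *\<^sub>C y\<close> are real, and
  the choices 1 and \<open>\<i>\<close> for \<open>c\<close> compare the imaginary and the real
  parts.\<close>

lemma positive_functional_star_mult: "f (star y * x) = cnj (f (star x * y))"
proof -
  have *: "f (star (x + c *\<^sub>C y) * (x + c *\<^sub>C y)) =
     f (star x * x) + c * f (star x * y) + cnj c * f (star y * x) + (c * cnj c) * f (star y * y)" for c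
    by (simp add: star_add star_scaleC distrib_left distrib_right mult_scaleC_left mult_scaleC_right
         positive_functional_simps scaleC_scaleC mult.commute)
  have Im: "Im (c * f (star x * y) + cnj c * f (star y * x)) = 0" for c
    using positive_functional_nonneg(3)[of "x + c *\<^sub>C y"] positive_functional_nonneg(3)[of x]
      positive_functional_nonneg(3)[of y] unfolding * by simp
  from Im[of 1] Im[of \<i>] show ?thesis by (simp add: complex_eq_iff)
qed

lemma positive_functional_star: "f (star x) = cnj (f x)"
  using positive_functional_star_mult[of x 1] by simp

lemma positive_functional_Cauchy_Schwarz:
  "(cmod (f (star x * y)))\<^sup>2 \<le> Re (f (star x * x)) * Re (f (star y * y))"
proof (rule quadratic_nonneg_imp)
  fix z
  have "f (star (x + z *\<^sub>C y) * (x + z *\<^sub>C y)) =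
     f (star x * x) + z * f (star x * y) + cnj (z * f (star x * y)) + (z * cnj z) * f (star y * y)"
    by (simp add: star_add star_scaleC distrib_left distrib_right mult_scaleC_left mult_scaleC_right
         positive_functional_simps scaleC_scaleC mult.commute positive_functional_star_mult[of y x])
  then show "0 \<le> Re (f (star x * x)) + 2 * Re (z * f (star x * y)) + (cmod z)\<^sup>2 * Re (f (star y * y))"
    using positive_functional_nonneg(2)[of "x + z *\<^sub>C y"]
    by (simp add: complex_norm_square[symmetric] flip: of_real_power)
qed (rule positive_functional_nonneg)

lemma positive_functional_null:
  assumes "f (star z * z) = 0"
  shows "f (w * z) = 0"
proof -
  have "(cmod (f (w * z)))\<^sup>2 \<le> 0"
    using positive_functional_Cauchy_Schwarz[of "star w" z] unfolding assms star_star by simp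
  then show ?thesis by simp
qed

lemma positive_functional_one: "0 \<le> Re (f 1)" "f 1 = of_real (Re (f 1))"
  using positive_functional_nonneg(2,3)[of 1] by (auto simp: complex_eq_iff)

text \<open>For \<open>r > norm h\<close> the element \<open>1 - h /\<^sub>R r\<close> is a square,
  so its value is nonnegative. Then \<open>r\<close> tends to \<open>norm h\<close>.\<close>

lemma positive_functional_selfadjoint_le:
  assumes "star h = h"
  shows "Re (f h) \<le> Re (f 1) * norm h"
proof -
  have "Re (f h) \<le> Re (f 1) * r" if r: "norm h < r" for r
  proof -
    have "0 < r" using r norm_ge_zero[of h] by linarith
    have "star (h /\<^sub>R r) = h /\<^sub>R r" "norm (h /\<^sub>R r) < 1"
      using assms r \<open>0 < r\<close> by (simp_all add: star_scaleR divide_simps)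
    then obtain y where y: "star y = y" "y * y = 1 - h /\<^sub>R r"
      by (rule sqrt_one_minus)
    have "0 \<le> Re (f (star y * y))"
      by (rule positive_functional_nonneg)
    also have "f (star y * y) = f 1 - f h /\<^sub>R r"
      unfolding y positive_functional_simps ..
    finally have "Re (f h) / r \<le> Re (f 1)"
      by (simp add: divide_inverse_commute)
    then show ?thesis using \<open>0 < r\<close> by (simp add: pos_divide_le_eq)
  qed
  note * = this
  show ?thesis
  proof (rule field_le_epsilon)
    fix e :: real
    assume "0 < e"
    \<comment> \<open>The summand 1 keeps the denominator positive when
      \<open>f 1 = 0\<close>.\<close>
    define d where "d = e / (Re (f 1) + 1)"
    have "0 < d"
      using positive_functional_one(1) \<open>0 < e\<close> by (simp add: d_def)
    have "Re (f 1) * d \<le> (Re (f 1) + 1) * d"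
      using \<open>0 < d\<close> by (intro mult_right_mono) auto
    also have "\<dots> = e"
      using positive_functional_one(1) by (simp add: d_def)
    finally have "Re (f 1) * d \<le> e" .
    with *[of "norm h + d"] \<open>0 < d\<close> show "Re (f h) \<le> Re (f 1) * norm h + e"
      by (simp add: distrib_left)
  qed
qed

text \<open>Cauchy-Schwarz against 1 reduces the claim to the selfadjoint element
  \<open>star x * x\<close>.\<close>

lemma positive_functional_bound: "cmod (f x) \<le> Re (f 1) * norm x"
proof -
  have "(cmod (f x))\<^sup>2 \<le> Re (f 1) * Re (f (star x * x))"
    using positive_functional_Cauchy_Schwarz[of 1 x] by simp
  also have "\<dots> \<le> Re (f 1) * (Re (f 1) * (norm x)\<^sup>2)"
    using positive_functional_selfadjoint_le[of "star x * x"] positive_functional_one(1)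
    by (intro mult_left_mono) (auto simp: star_mult star_star cstar_identity)
  also have "\<dots> = (Re (f 1) * norm x)\<^sup>2" by (simp add: power2_eq_square)
  finally show ?thesis
    by (rule power2_le_imp_le) (simp add: positive_functional_one(1))
qed

lemma positive_functional_bounded_linear: "bounded_linear f"
proof (rule bounded_linear_intro)
  show "norm (f x) \<le> norm x * Re (f 1)" for x
    using positive_functional_bound[of x] by (simp only: mult.commute)
qed (rule positive_functional_simps)+

text \<open>Sandwiching the partition of unity between two copies of \<open>p j\<close> shows that
  the squares of \<open>p i * p j * y\<close> with \<open>i \<noteq> j\<close> have values summing
  to 0. As these values are nonnegative, each vanishes, and null vectors are annihilated from the
  left. The factors \<open>w\<close> and \<open>y\<close> let the relation be used in the middle of
  a word.\<close>

lemma positive_functional_projections_orthogonal: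
  assumes "finite I" "\<And>i. i \<in> I \<Longrightarrow> projection (p i)" "(\<Sum>i\<in>I. p i) = 1"
    and ij: "i \<in> I" "j \<in> I" "i \<noteq> j"
  shows "f (w * (p i * p j) * y) = 0"
proof -
  have proj: "star (p i) = p i" "p i * p i = p i" if "i \<in> I" for i
    using assms(2)[OF that] by (auto simp: projection_def)
  have eq: "f (star (p i * p j * y) * (p i * p j * y)) = f (star y * p j * p i * p j * y)"
    if "i \<in> I" for i
  proof -
    have "star (p i * p j * y) * (p i * p j * y) = star y * p j * (p i * p i) * p j * y"
      using that ij by (simp add: star_mult proj(1) mult.assoc)
    then show ?thesis using that by (simp add: proj)
  qed
  have "(\<Sum>i\<in>I. f (star y * p j * p i * p j * y)) = f (star y * p j * (\<Sum>i\<in>I. p i) * p j * y)"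
    by (simp add: positive_functional_sum sum_distrib_left sum_distrib_right)
  also have "star y * p j * (\<Sum>i\<in>I. p i) * p j * y = star y * (p j * p j) * y"
    using assms(3) by (simp add: mult.assoc)
  \<comment> \<open>The extra \<open>p j\<close> gives the right-hand side the shape of the summand
    with index \<open>j\<close>, which then cancels.\<close>
  also have "\<dots> = star y * p j * (p j * p j) * y"
    using proj(2)[OF ij(2)] by (simp add: mult.assoc)
  also have "\<dots> = star y * p j * p j * p j * y"
    by (simp add: mult.assoc)
  finally have "(\<Sum>i\<in>I - {j}. f (star y * p j * p i * p j * y)) = 0"
    using assms(1) ij by (simp add: sum.remove[of I j])
  then have "(\<Sum>i\<in>I - {j}. f (star (p i * p j * y) * (p i * p j * y))) = 0"
    by (simp add: eq)
  then have "(\<Sum>i\<in>I - {j}. Re (f (star (p i * p j * y) * (p i * p j * y)))) = 0"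
    by (simp flip: Re_sum)
  then have "Re (f (star (p i * p j * y) * (p i * p j * y))) = 0"
    using assms(1) ij by (subst (asm) sum_nonneg_eq_0_iff) (auto simp: positive_functional_nonneg)
  then have "f (star (p i * p j * y) * (p i * p j * y)) = 0"
    using positive_functional_nonneg(3)[of "p i * p j * y"] by (simp add: complex_eq_iff)
  from positive_functional_null[OF this, of w] show ?thesis by (simp add: mult.assoc)
qed

end

lemma positive_functional_blinfun:
  assumes "state \<phi>"
  shows "positive_functional (blinfun_apply \<phi>)"
  using assms by (auto simp: state_def positive_functional_def blinfun.add_right)

text \<open>The bound above gives \<open>norm \<phi> \<le> Re (\<phi> 1)\<close>, while
  \<open>norm \<phi> = 1\<close> bounds \<open>\<phi> 1\<close> from the other side.\<close>

lemma state_one: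
  assumes "state \<phi>"
  shows "\<phi> 1 = 1"
proof -
  note p = positive_functional_blinfun[OF assms]
  have n: "norm \<phi> = 1" using assms by (simp add: state_def)
  have "norm \<phi> \<le> Re (\<phi> 1)"
    by (rule norm_blinfun_bound) (use positive_functional_one(1)[OF p] positive_functional_bound[OF p] in auto)
  moreover have "cmod (\<phi> 1) \<le> 1"
    using norm_blinfun[of \<phi> 1] n by simp
  then have "Re (\<phi> 1) \<le> 1"
    using complex_Re_le_cmod[of "\<phi> 1"] by linarith
  ultimately show ?thesis
    using positive_functional_one(2)[OF p] n by simp
qed


section \<open>Tensor products of states\<close>

definition psd_matrix :: "nat \<Rightarrow> (nat \<Rightarrow> nat \<Rightarrow> complex) \<Rightarrow> bool" where
  "psd_matrix n M \<longleftrightarrow> (\<forall>i<n. \<forall>j<n. M j i = cnj (M i j)) \<and>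
     (\<forall>x. 0 \<le> Re (\<Sum>i<n. \<Sum>j<n. cnj (x i) * M i j * x j))"

lemma psd_matrix_Gram:
  assumes "positive_functional f"
  shows "psd_matrix n (\<lambda>i j. f (star (a i) * a j))"
  unfolding psd_matrix_def
proof (intro conjI allI impI)
  fix x :: "nat \<Rightarrow> complex"
  let ?s = "\<Sum>i<n. x i *\<^sub>C a i"
  have "star ?s * ?s = (\<Sum>i<n. \<Sum>j<n. (x j * cnj (x i)) *\<^sub>C (star (a i) * a j))"
    by (simp add: star_sum star_scaleC sum_product mult_scaleC_left mult_scaleC_right scaleC_scaleC)
  then have "f (star ?s * ?s) = (\<Sum>i<n. \<Sum>j<n. cnj (x i) * f (star (a i) * a j) * x j)"
    by (simp add: positive_functional_sum[OF assms] positive_functional_simps[OF assms] mult_ac)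
  then show "0 \<le> Re (\<Sum>i<n. \<Sum>j<n. cnj (x i) * f (star (a i) * a j) * x j)"
    using positive_functional_nonneg(2)[OF assms, of ?s] by simp
qed (rule positive_functional_star_mult[OF assms])

text \<open>
  Induction on the size, splitting \<open>M\<close> into its Schur complement and a matrix of rank one.
\<close>

lemma Schur_product_nonneg:
  assumes "psd_matrix n M" "psd_matrix n K"
  shows "0 \<le> Re (\<Sum>i<n. \<Sum>j<n. M i j * K i j)"
  using assms
proof (induction n arbitrary: M)
  case (Suc n)
  have herm: "M j i = cnj (M i j)" if "i \<le> n" "j \<le> n" for i j
    using Suc.prems(1) that unfolding psd_matrix_def less_Suc_eq_le by blast
  have row: "M n i = cnj (M i n)" if "i < n" for i
    using herm[of i n] that by simp
  define a where "a = Re (M n n)"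
  have Mnn: "M n n = of_real a"
    using herm[of n n] by (simp add: a_def complex_eq_iff)
  define Q where "Q x = (\<Sum>i<n. \<Sum>j<n. cnj (x i) * M i j * x j)" for x
  define c where "c x = (\<Sum>i<n. cnj (x i) * M i n)" for x
  \<comment> \<open>Extending \<open>x\<close> by a last coordinate \<open>z\<close> turns the
    quadratic form of \<open>M\<close> into a quadratic in \<open>z\<close>, whose discriminant is
    bounded.\<close>
  have minor: "(cmod (c x))\<^sup>2 \<le> Re (Q x) * a" and "0 \<le> a" for x
  proof -
    have nonneg: "0 \<le> Re (Q x) + 2 * Re (z * c x) + (cmod z)\<^sup>2 * a" for x z
    proof -
      let ?x = "x(n := z)"
      have "(\<Sum>j<n. cnj z * M n j * x j) = cnj (z * c x)"
        unfolding c_def by (auto simp: sum_distrib_left row mult_ac intro!: sum.cong)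
      moreover have "(\<Sum>i<n. cnj (x i) * M i n * z) = z * c x"
        unfolding c_def by (auto simp: sum_distrib_left mult_ac)
      ultimately have "(\<Sum>i<Suc n. \<Sum>j<Suc n. cnj (?x i) * M i j * ?x j) =
          Q x + z * c x + cnj (z * c x) + cnj z * of_real a * z"
        by (simp add: Q_def sum.distrib Mnn)
      moreover have "0 \<le> Re (\<Sum>i<Suc n. \<Sum>j<Suc n. cnj (?x i) * M i j * ?x j)"
        using Suc.prems(1) unfolding psd_matrix_def by blast
      moreover have "cnj z * of_real a * z = of_real ((cmod z)\<^sup>2 * a)"
        unfolding of_real_mult complex_norm_square by (simp only: mult_ac)
      ultimately show ?thesis by simp
    qed
    show "0 \<le> a" using nonneg[of "\<lambda>_. 0" 1] by (simp add: Q_def c_def)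
    then show "(cmod (c x))\<^sup>2 \<le> Re (Q x) * a"
      by (intro quadratic_nonneg_imp nonneg)
  qed
  \<comment> \<open>The Schur complement of the last diagonal entry. If \<open>a = 0\<close>,
    division by zero gives \<open>M' = M\<close>, which is the right value since the last row and
    column then vanish.\<close>
  define M' where "M' i j = M i j - M i n * M n j / of_real a" for i j
  have "psd_matrix n M'"
    unfolding psd_matrix_def
  proof (intro conjI allI impI)
    fix x
    have c2: "c x * cnj (c x) = (\<Sum>i<n. \<Sum>j<n. cnj (x i) * (M i n * M n j) * x j)"
      unfolding c_def cnj_sum sum_product by (intro sum.cong refl) (simp add: row mult_ac)
    have "(\<Sum>i<n. \<Sum>j<n. cnj (x i) * M' i j * x j) = Q x - c x * cnj (c x) / of_real a"
      unfolding c2 by (simp add: M'_def Q_def algebra_simps sum_subtractf sum_divide_distrib)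
    also have "c x * cnj (c x) / of_real a = of_real ((cmod (c x))\<^sup>2 / a)"
      by (simp flip: complex_norm_square)
    finally have "Re (\<Sum>i<n. \<Sum>j<n. cnj (x i) * M' i j * x j) = Re (Q x) - (cmod (c x))\<^sup>2 / a"
      by simp
    moreover have "(cmod (c x))\<^sup>2 / a \<le> Re (Q x)"
    proof (cases "a = 0")
      case True
      have "Re (Q x) \<ge> 0"
      proof -
        have "0 \<le> Re (\<Sum>i<Suc n. \<Sum>j<Suc n. cnj ((x(n := 0)) i) * M i j * (x(n := 0)) j)"
          using Suc.prems(1) unfolding psd_matrix_def by blast
        then show ?thesis by (simp add: Q_def)
      qed
      then show ?thesis using True by simp
    qed (use minor[of x] \<open>0 \<le> a\<close> in \<open>simp add: divide_simps\<close>)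
    ultimately show "0 \<le> Re (\<Sum>i<n. \<Sum>j<n. cnj (x i) * M' i j * x j)" by simp
  next
    fix i j assume "i < n" "j < n"
    then show "M' j i = cnj (M' i j)"
      by (simp add: M'_def herm[of i j] row)
  qed
  moreover have "psd_matrix n K"
    unfolding psd_matrix_def
  proof (intro conjI allI impI)
    fix x
    have "0 \<le> Re (\<Sum>i<Suc n. \<Sum>j<Suc n. cnj ((x(n := 0)) i) * K i j * (x(n := 0)) j)"
      using Suc.prems(2) unfolding psd_matrix_def by blast
    then show "0 \<le> Re (\<Sum>i<n. \<Sum>j<n. cnj (x i) * K i j * x j)" by simp
  next
    fix i j assume "i < n" "j < n"
    with Suc.prems(2) show "K j i = cnj (K i j)"
      unfolding psd_matrix_def by (meson less_SucI)
  qed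
  ultimately have IH: "0 \<le> Re (\<Sum>i<n. \<Sum>j<n. M' i j * K i j)"
    by (rule Suc.IH)
  \<comment> \<open>The matrix removed from \<open>M\<close> has entries
    \<open>cnj (y i) * y j / of_real a\<close>, so it contributes the quadratic form of
    \<open>K\<close> at the last row of \<open>M\<close>, divided by \<open>a\<close>.\<close>
  define y where "y = (\<lambda>i. M n i)"
  have "0 \<le> Re (\<Sum>i<Suc n. \<Sum>j<Suc n. cnj (y i) * K i j * y j)"
    using Suc.prems(2) unfolding psd_matrix_def by blast
  then have R: "0 \<le> Re ((\<Sum>i<Suc n. \<Sum>j<Suc n. cnj (y i) * K i j * y j) / of_real a)"
    using \<open>0 \<le> a\<close> by simp
  have "(\<Sum>i<Suc n. \<Sum>j<Suc n. M i j * K i j) =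
      (\<Sum>i<n. \<Sum>j<n. M' i j * K i j) + (\<Sum>i<Suc n. \<Sum>j<Suc n. cnj (y i) * K i j * y j) / of_real a"
  proof (cases "a = 0")
    case True
    \<comment> \<open>For \<open>a = 0\<close> the bound \<open>minor\<close> forces
      \<open>c\<close> to vanish, and on unit vectors \<open>c\<close> reads off the last
      column.\<close>
    have "M i n = 0" if "i < n" for i
    proof -
      have "c (\<lambda>k. if k = i then 1 else 0) = (\<Sum>k<n. if k = i then M k n else 0)"
        unfolding c_def by (intro sum.cong refl) auto
      also have "\<dots> = M i n" using that by simp
      finally have "c (\<lambda>k. if k = i then 1 else 0) = M i n" .
      then show ?thesis using minor[of "\<lambda>k. if k = i then 1 else 0"] True by simp
    qed
    moreover have "M n i = 0" if "i < n" for i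
      using herm[of i n] that calculation[OF that] by simp
    ultimately show ?thesis using True by (simp add: M'_def Mnn)
  next
    case False
    have "(\<Sum>i<n. \<Sum>j<n. M i j * K i j) =
        (\<Sum>i<n. \<Sum>j<n. M' i j * K i j) + (\<Sum>i<n. \<Sum>j<n. cnj (y i) * K i j * y j) / of_real a"
      unfolding sum_divide_distrib sum.distrib[symmetric]
      by (intro sum.cong refl) (simp add: M'_def y_def row algebra_simps)
    moreover have "(\<Sum>i<n. M i n * K i n) = (\<Sum>i<n. cnj (y i) * K i n * y n) / of_real a"
      unfolding sum_divide_distrib
      using False by (intro sum.cong refl) (simp add: y_def Mnn row)
    moreover have "(\<Sum>j<n. M n j * K n j) = (\<Sum>j<n. cnj (y n) * K n j * y j) / of_real a"
      unfolding sum_divide_distrib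
      using False by (intro sum.cong refl) (simp add: y_def Mnn)
    moreover have "M n n * K n n = cnj (y n) * K n n * y n / of_real a"
      using False by (simp add: y_def Mnn)
    ultimately show ?thesis
      by (simp add: sum.distrib add_divide_distrib)
  qed
  with IH R show ?case by simp
qed simp

section \<open>The functional \<phi> \<otimes> \<psi> on algebraic tensors\<close>

lemma alg_functional_append: "alg_functional \<phi> \<psi> (xs @ ys) = alg_functional \<phi> \<psi> xs + alg_functional \<phi> \<psi> ys"
  by (simp add: alg_functional_def)

lemma alg_functional_alg_mult_star:
  "alg_functional \<phi> \<psi> (alg_mult (alg_star xs) ys) = (\<Sum>i<length xs. \<Sum>j<length ys.
     \<phi> (star (fst (xs ! i)) * fst (ys ! j)) * \<psi> (star (snd (xs ! i)) * snd (ys ! j)))"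
proof -
  have "alg_functional \<phi> \<psi> (alg_mult (alg_star xs) ys) = (\<Sum>p\<leftarrow>xs. \<Sum>q\<leftarrow>ys.
     \<phi> (star (fst p) * fst q) * \<psi> (star (snd p) * snd q))"
    by (induction xs)
       (auto simp: alg_functional_def alg_mult_def alg_star_def case_prod_unfold o_def)
  then show ?thesis by (simp add: sum_list_sum_nth atLeast0LessThan)
qed

text \<open>Scaling the first leg alone multiplies the represented tensor by
  \<open>c\<close>.\<close>

definition tensor_scale :: "complex \<Rightarrow> ('a::cstar_algebra \<times> 'b) list \<Rightarrow> ('a \<times> 'b) list" where
  "tensor_scale c xs = map (\<lambda>(a, b). (c *\<^sub>C a, b)) xs"

lemma alg_mult_append: "alg_mult (xs @ ys) zs = alg_mult xs zs @ alg_mult ys zs"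
  by (simp add: alg_mult_def)

lemma alg_star_append: "alg_star (xs @ ys) = alg_star xs @ alg_star ys"
  by (simp add: alg_star_def)

context
  fixes \<phi> :: "'a::cstar_algebra \<Rightarrow>\<^sub>L complex" and \<psi> :: "'b::cstar_algebra \<Rightarrow>\<^sub>L complex"
  assumes states: "state \<phi>" "state \<psi>"
begin

private lemma pos: "positive_functional (blinfun_apply \<phi>)" "positive_functional (blinfun_apply \<psi>)"
  using states by (auto intro: positive_functional_blinfun)

private abbreviation E where "E xs ys \<equiv> alg_functional \<phi> \<psi> (alg_mult (alg_star xs) ys)"

lemma alg_functional_scale: "alg_functional \<phi> \<psi> (tensor_scale c xs) = c * alg_functional \<phi> \<psi> xs"
  by (induction xs)
     (auto simp: alg_functional_def tensor_scale_def positive_functional_simps[OF pos(1)] distrib_left)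

lemma alg_functional_hermitian: "E ys xs = cnj (E xs ys)"
proof -
  have "E ys xs = (\<Sum>j<length xs. \<Sum>i<length ys.
     \<phi> (star (fst (ys ! i)) * fst (xs ! j)) * \<psi> (star (snd (ys ! i)) * snd (xs ! j)))"
    unfolding alg_functional_alg_mult_star by (rule sum.swap)
  also have "\<dots> = cnj (E xs ys)"
    unfolding alg_functional_alg_mult_star cnj_sum complex_cnj_mult
    by (intro sum.cong refl arg_cong2[of _ _ _ _ "(*)"] positive_functional_star_mult pos)
  finally show ?thesis .
qed

lemma alg_functional_append_right: "E xs (ys @ zs) = E xs ys + E xs zs"
  by (metis alg_functional_append alg_functional_hermitian alg_mult_append alg_star_append complex_cnj_add)

lemma alg_functional_append_left: "E (xs @ ys) zs = E xs zs + E ys zs"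
  by (simp add: alg_functional_append alg_mult_append alg_star_append)

lemma alg_functional_scale_right: "E xs (tensor_scale c ys) = c * E xs ys"
  by (simp add: alg_functional_alg_mult_star tensor_scale_def case_prod_unfold mult_scaleC_right
      positive_functional_simps[OF pos(1)] sum_distrib_left mult_ac)

lemma alg_functional_scale_left: "E (tensor_scale c xs) ys = cnj c * E xs ys"
  by (metis alg_functional_hermitian alg_functional_scale_right complex_cnj_mult complex_cnj_cnj)

text \<open>The double sum pairs the entries of two Gram matrices, so the Schur product theorem
  applies.\<close>

lemma alg_functional_square_nonneg: "E xs xs \<in> \<real>\<^sub>\<ge>\<^sub>0" "0 \<le> Re (E xs xs)"
proof -
  show "0 \<le> Re (E xs xs)"
    unfolding alg_functional_alg_mult_star
    by (rule Schur_product_nonneg; rule psd_matrix_Gram[OF pos(1)] psd_matrix_Gram[OF pos(2)])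
  then show "E xs xs \<in> \<real>\<^sub>\<ge>\<^sub>0"
    using alg_functional_hermitian[of xs xs] by (simp add: complex_nonneg_Reals_iff complex_eq_iff)
qed

text \<open>Half of the parallelogram law: the square of the difference of the two tensors is
  nonnegative.\<close>

lemma alg_functional_square_append:
  "Re (E (xs @ ys) (xs @ ys)) \<le> 2 * Re (E xs xs) + 2 * Re (E ys ys)"
  using alg_functional_square_nonneg(2)[of "xs @ tensor_scale (-1) ys"]
  by (simp add: alg_functional_append_left alg_functional_append_right alg_functional_scale_left
      alg_functional_scale_right)

text \<open>With everything else fixed, the expression is a positive functional \<open>g\<close> of
  \<open>star a * a\<close>. Bounding \<open>g\<close> by its value at 1 removes \<open>a\<close>;
  what remains is a positive functional \<open>h\<close> of \<open>star b * b\<close>, and the same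
  bound removes \<open>b\<close>.\<close>

lemma alg_functional_elementary_bound:
  "Re (E (alg_mult [(a, b)] ys) (alg_mult [(a, b)] ys)) \<le> (norm a)\<^sup>2 * (norm b)\<^sup>2 * Re (E ys ys)"
proof -
  define n where "n = length ys"
  define c where "c i = fst (ys ! i)" for i
  define d where "d i = snd (ys ! i)" for i
  have E: "E (alg_mult [(a, b)] ys) (alg_mult [(a, b)] ys) =
      (\<Sum>i<n. \<Sum>j<n. \<phi> (star (a * c i) * (a * c j)) * \<psi> (star (b * d i) * (b * d j)))"
    unfolding alg_functional_alg_mult_star
    by (simp add: alg_mult_def n_def c_def d_def case_prod_unfold)
  define g where "g x = (\<Sum>i<n. \<Sum>j<n. \<phi> (star (c i) * x * c j) * \<psi> (star (b * d i) * (b * d j)))" for x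
  define h where "h y = (\<Sum>i<n. \<Sum>j<n. \<phi> (star (c i) * c j) * \<psi> (star (d i) * y * d j))" for y
  note s1 = positive_functional_simps[OF pos(1)] and s2 = positive_functional_simps[OF pos(2)]
  have "positive_functional g"
    unfolding positive_functional_def
  proof (intro conjI allI)
    fix x
    have *: "star (c i) * (star x * x) * c j = star (x * c i) * (x * c j)" for i j
      by (simp add: star_mult mult.assoc)
    have "g (star x * x) = E (map (\<lambda>i. (x * c i, b * d i)) [0..<n]) (map (\<lambda>i. (x * c i, b * d i)) [0..<n])"
      unfolding g_def * alg_functional_alg_mult_star by simp
    then show "g (star x * x) \<in> \<real>\<^sub>\<ge>\<^sub>0" using alg_functional_square_nonneg by simp
  qed (simp_all add: g_def algebra_simps sum.distrib mult_scaleC_right mult_scaleC_left s1 sum_distrib_left)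
  moreover have "positive_functional h"
    unfolding positive_functional_def
  proof (intro conjI allI)
    fix x
    have *: "star (d i) * (star x * x) * d j = star (x * d i) * (x * d j)" for i j
      by (simp add: star_mult mult.assoc)
    have "h (star x * x) = E (map (\<lambda>i. (c i, x * d i)) [0..<n]) (map (\<lambda>i. (c i, x * d i)) [0..<n])"
      unfolding h_def * alg_functional_alg_mult_star by simp
    then show "h (star x * x) \<in> \<real>\<^sub>\<ge>\<^sub>0" using alg_functional_square_nonneg by simp
  qed (simp_all add: h_def algebra_simps sum.distrib mult_scaleC_right mult_scaleC_left s2 sum_distrib_left)
  ultimately have g: "Re (g (star a * a)) \<le> Re (g 1) * (norm a)\<^sup>2"
    and h: "Re (h (star b * b)) \<le> Re (h 1) * (norm b)\<^sup>2"
    using positive_functional_selfadjoint_le[of g "star a * a"]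
      positive_functional_selfadjoint_le[of h "star b * b"]
    by (simp_all add: star_mult star_star cstar_identity)
  have "g (star a * a) = E (alg_mult [(a, b)] ys) (alg_mult [(a, b)] ys)"
    unfolding E g_def by (simp add: star_mult mult.assoc)
  moreover have "g 1 = h (star b * b)"
    unfolding g_def h_def by (simp add: star_mult mult.assoc)
  moreover have "h 1 = E ys ys"
    unfolding h_def alg_functional_alg_mult_star c_def d_def n_def by simp
  ultimately have "Re (E (alg_mult [(a, b)] ys) (alg_mult [(a, b)] ys)) \<le> Re (h (star b * b)) * (norm a)\<^sup>2"
    and "Re (h (star b * b)) \<le> Re (E ys ys) * (norm b)\<^sup>2"
    using g h by simp_all
  then show ?thesis
    using mult_right_mono[of "Re (h (star b * b))" "Re (E ys ys) * (norm b)\<^sup>2" "(norm a)\<^sup>2"]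
    by (simp add: mult_ac)
qed

lemma alg_functional_Cauchy_Schwarz: "(cmod (alg_functional \<phi> \<psi> xs))\<^sup>2 \<le> Re (E xs xs)"
proof -
  let ?c = "alg_functional \<phi> \<psi> xs"
  have "alg_mult (alg_star [(1, 1)]) xs = xs"
    by (simp add: alg_mult_def alg_star_def case_prod_unfold)
  then have 1: "E [(1, 1)] xs = ?c" by simp
  have 2: "E xs [(1, 1)] = cnj ?c"
    using alg_functional_hermitian[of xs "[(1, 1)]"] 1 by simp
  have 3: "E [(1, 1)] [(1, 1)] = 1"
    using states by (simp add: alg_mult_def alg_star_def alg_functional_def state_one)
  \<comment> \<open>The component of \<open>xs\<close> along the unit vector 1 \<otimes> 1 is
    subtracted, and the square of the remainder is nonnegative.\<close>
  have "E (xs @ tensor_scale (- ?c) [(1, 1)]) (xs @ tensor_scale (- ?c) [(1, 1)]) = E xs xs - ?c * cnj ?c"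
    by (simp add: alg_functional_append_left alg_functional_append_right alg_functional_scale_left
      alg_functional_scale_right 1 2 3)
  then show ?thesis
    using alg_functional_square_nonneg(2)[of "xs @ tensor_scale (- ?c) [(1, 1)]"]
    by (simp flip: complex_norm_square)
qed

end

text \<open>The supremum in the definition of the spatial norm is a junk value unless the set is bounded.\<close>

lemma spatial_norm_bdd_above:
  fixes xs :: "('a::cstar_algebra \<times> 'b::cstar_algebra) list"
  shows "bdd_above {sqrt (Re (alg_functional \<phi> \<psi>
        (alg_mult (alg_star (alg_mult xs ys)) (alg_mult xs ys)))) | \<phi> \<psi> ys.
      state \<phi> \<and> state \<psi> \<and> alg_functional \<phi> \<psi> (alg_mult (alg_star ys) ys) = 1}"
proof -
  have "\<exists>C. \<forall>\<phi> \<psi> ys. state \<phi> \<and> state \<psi> \<longrightarrow>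
      Re (alg_functional \<phi> \<psi> (alg_mult (alg_star (alg_mult xs ys)) (alg_mult xs ys)))
      \<le> C * Re (alg_functional \<phi> \<psi> (alg_mult (alg_star ys) ys))"
  proof (induction xs)
    case Nil
    show ?case by (rule exI[of _ 0]) (simp add: alg_mult_def alg_star_def alg_functional_def)
  next
    case (Cons p xs)
    obtain a b where p: "p = (a, b)" by (cases p)
    from Cons obtain C where C: "\<And>\<phi> \<psi> ys. state \<phi> \<Longrightarrow> state \<psi> \<Longrightarrow>
      Re (alg_functional \<phi> \<psi> (alg_mult (alg_star (alg_mult xs ys)) (alg_mult xs ys)))
      \<le> C * Re (alg_functional \<phi> \<psi> (alg_mult (alg_star ys) ys))" by blast
    have split: "alg_mult (p # xs) ys = alg_mult [(a, b)] ys @ alg_mult xs ys" for ys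
      by (simp add: alg_mult_def p)
    show ?case
    proof (intro exI allI impI, elim conjE)
      fix \<phi> :: "'a \<Rightarrow>\<^sub>L complex" and \<psi> :: "'b \<Rightarrow>\<^sub>L complex" and ys
      assume s: "state \<phi>" "state \<psi>"
      show "Re (alg_functional \<phi> \<psi> (alg_mult (alg_star (alg_mult (p # xs) ys)) (alg_mult (p # xs) ys)))
        \<le> (2 * (norm a)\<^sup>2 * (norm b)\<^sup>2 + 2 * C) * Re (alg_functional \<phi> \<psi> (alg_mult (alg_star ys) ys))"
        using alg_functional_square_append[OF s, of "alg_mult [(a, b)] ys" "alg_mult xs ys"]
          alg_functional_elementary_bound[OF s, of a b ys] C[OF s, of ys]
        unfolding split distrib_right by linarith
    qed
  qed
  then obtain C where C: "\<And>\<phi> \<psi> ys. state \<phi> \<Longrightarrow> state \<psi> \<Longrightarrow>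
      Re (alg_functional \<phi> \<psi> (alg_mult (alg_star (alg_mult xs ys)) (alg_mult xs ys)))
      \<le> C * Re (alg_functional \<phi> \<psi> (alg_mult (alg_star ys) ys))" by blast
  show ?thesis
  proof (rule bdd_aboveI[of _ "sqrt C"], clarify)
    fix \<phi> :: "'a \<Rightarrow>\<^sub>L complex" and \<psi> :: "'b \<Rightarrow>\<^sub>L complex" and ys
    assume "state \<phi>" "state \<psi>" "alg_functional \<phi> \<psi> (alg_mult (alg_star ys) ys) = 1"
    then show "sqrt (Re (alg_functional \<phi> \<psi> (alg_mult (alg_star (alg_mult xs ys)) (alg_mult xs ys)))) \<le> sqrt C"
      using C[of \<phi> \<psi> ys] by simp
  qed
qed

text \<open>The tensor 1 \<otimes> 1 is an admissible unit vector in the supremum, and applying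
  \<open>xs\<close> to it already gives the Cauchy-Schwarz bound for the functional.\<close>

lemma alg_functional_le_spatial_norm:
  assumes "state \<phi>" "state \<psi>"
  shows "cmod (alg_functional \<phi> \<psi> xs) \<le> spatial_norm xs"
proof -
  have "cmod (alg_functional \<phi> \<psi> xs) \<le> sqrt (Re (alg_functional \<phi> \<psi> (alg_mult (alg_star xs) xs)))"
    using alg_functional_Cauchy_Schwarz[OF assms, of xs] by (simp add: real_le_rsqrt)
  also have "\<dots> \<le> spatial_norm xs"
    unfolding spatial_norm_def
  proof (rule cSup_upper[OF _ spatial_norm_bdd_above], intro CollectI exI conjI)
    have "alg_mult xs [(1, 1)] = xs"
      by (induction xs) (auto simp: alg_mult_def)
    then show "sqrt (Re (alg_functional \<phi> \<psi> (alg_mult (alg_star xs) xs))) =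
      sqrt (Re (alg_functional \<phi> \<psi> (alg_mult (alg_star (alg_mult xs [(1, 1)])) (alg_mult xs [(1, 1)]))))"
      by simp
    show "alg_functional \<phi> \<psi> (alg_mult (alg_star [(1, 1)]) [(1, 1)]) = 1"
      using assms by (simp add: alg_mult_def alg_star_def alg_functional_def state_one)
  qed (rule assms)+
  finally show ?thesis .
qed

section \<open>Extension and comparison of maps on dense subspaces\<close>

lemma blinfun_extension_dense:
  fixes f :: "'v::real_normed_vector \<Rightarrow> 'w::banach"
  assumes D: "subspace D" "closure D = UNIV"
    and add: "\<And>x y. x \<in> D \<Longrightarrow> y \<in> D \<Longrightarrow> f (x + y) = f x + f y"
    and scale: "\<And>r x. x \<in> D \<Longrightarrow> f (r *\<^sub>R x) = r *\<^sub>R f x"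
    and bound: "\<And>x. x \<in> D \<Longrightarrow> norm (f x) \<le> norm x * B"
  obtains F :: "'v \<Rightarrow>\<^sub>L 'w" where "\<And>x. x \<in> D \<Longrightarrow> F x = f x"
proof -
  have "norm (f x - f y) \<le> \<bar>B\<bar> * norm (x - y)" if "x \<in> D" "y \<in> D" for x y
  proof -
    have "x - y \<in> D" using D(1) that by (rule subspace_diff)
    then have "f x - f y = f (x - y)"
      using add[of "x - y" y] that by simp
    also have "norm \<dots> \<le> norm (x - y) * B" using bound[OF \<open>x - y \<in> D\<close>] .
    also have "\<dots> \<le> \<bar>B\<bar> * norm (x - y)" by (simp add: mult.commute mult_right_mono)
    finally show ?thesis .
  qed
  then have "\<bar>B\<bar>-lipschitz_on D f" by (intro lipschitz_onI) (auto simp: dist_norm)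
  then have "uniformly_continuous_on D f"
    by (rule lipschitz_on_uniformly_continuous)
  then obtain g where g: "uniformly_continuous_on (closure D) g" "\<And>x. x \<in> D \<Longrightarrow> f x = g x"
    by (rule uniformly_continuous_on_extension_on_closure) blast
  have cont: "continuous_on UNIV g"
    using g(1) uniformly_continuous_imp_continuous D(2) by metis
  have dense: "P x" if "closed {x. P x}" "\<And>x. x \<in> D \<Longrightarrow> P x" for P and x :: 'v
    using closure_minimal[of D "{x. P x}"] that D(2) by auto
  have cont': "continuous_on UNIV (\<lambda>x. g (h x))" if "continuous_on UNIV h" for h :: "'v \<Rightarrow> 'v"
    by (rule continuous_on_compose2[OF cont that]) auto
  \<comment> \<open>Additivity passes to the closure one variable at a time.\<close>
  have add1: "g (x + y) = g x + g y" if "y \<in> D" for x y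
    by (rule dense[of "\<lambda>x. g (x + y) = g x + g y"])
       (use that in \<open>auto intro!: closed_Collect_eq continuous_intros cont' simp: g(2)[symmetric] add subspace_add[OF D(1)]\<close>)
  have "g (x + y) = g x + g y" for x y
    by (rule dense[of "\<lambda>y. g (x + y) = g x + g y"])
       (auto intro!: closed_Collect_eq continuous_intros cont' simp: add1)
  moreover have "g (r *\<^sub>R x) = r *\<^sub>R g x" for r x
    by (rule dense[of "\<lambda>x. g (r *\<^sub>R x) = r *\<^sub>R g x"])
       (auto intro!: closed_Collect_eq continuous_intros cont' simp: g(2)[symmetric] scale subspace_scale[OF D(1)])
  moreover have "norm (g x) \<le> norm x * B" for x
    by (rule dense[of "\<lambda>x. norm (g x) \<le> norm x * B"])
       (use bound g(2) in \<open>auto intro!: closed_Collect_le continuous_intros cont'\<close>)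
  ultimately have "bounded_linear g" by (rule bounded_linear_intro)
  then show ?thesis using that[of "Blinfun g"] g(2) by (simp add: bounded_linear_Blinfun_apply)
qed

lemma blinfun_eqI_dense:
  assumes "closure (span X) = UNIV" "\<And>x. x \<in> X \<Longrightarrow> blinfun_apply F x = blinfun_apply G x"
  shows "F = G"
proof (rule blinfun_eqI)
  fix x
  have "span X \<subseteq> {x. F x = G x}"
    using assms(2) linear_eq_on_span[of F G X]
    by (auto intro: bounded_linear.linear[OF blinfun.bounded_linear_right])
  then have "closure (span X) \<subseteq> {x. F x = G x}"
    by (rule closure_minimal) (auto intro!: closed_Collect_eq continuous_intros)
  then show "F x = G x" using assms(1) by auto
qed

lemma closure_UNIV_induct:
  assumes "closure D = UNIV" "closed {x. P x}" "\<And>x. x \<in> D \<Longrightarrow> P x"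
  shows "P x"
  using closure_minimal[of D "{x. P x}"] assms by auto

section \<open>Product states on the completed tensor product\<close>

definition tensor_sum ::
    "('a::cstar_algebra \<Rightarrow> 'b::cstar_algebra \<Rightarrow> 'c::cstar_algebra) \<Rightarrow> ('a \<times> 'b) list \<Rightarrow> 'c"
  where "tensor_sum t xs = (\<Sum>(a, b)\<leftarrow>xs. t a b)"

context
  fixes t :: "'a::cstar_algebra \<Rightarrow> 'b::cstar_algebra \<Rightarrow> 'c::cstar_algebra"
  assumes t: "minimal_tensor_product t"
begin

lemma dense_elementary_tensors: "closure (span {t a b | a b. True}) = UNIV"
  using t by (simp add: minimal_tensor_product_def)

lemma tensor_sum_append: "tensor_sum t (xs @ ys) = tensor_sum t xs + tensor_sum t ys"
  by (simp add: tensor_sum_def)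

lemma tensor_sum_scale: "tensor_sum t (tensor_scale c xs) = c *\<^sub>C tensor_sum t xs"
proof -
  have "t (c *\<^sub>C a) b = c *\<^sub>C t a b" for a b
    using t by (simp add: minimal_tensor_product_def clinear_def)
  then show ?thesis
    by (induction xs) (auto simp: tensor_sum_def tensor_scale_def scaleC_add_right)
qed

lemma tensor_sum_star: "tensor_sum t (alg_star xs) = star (tensor_sum t xs)"
proof -
  have "star (t a b) = t (star a) (star b)" for a b
    using t by (simp add: minimal_tensor_product_def)
  then show ?thesis
    by (induction xs) (auto simp: tensor_sum_def alg_star_def star_add)
qed

lemma tensor_sum_mult: "tensor_sum t (alg_mult xs ys) = tensor_sum t xs * tensor_sum t ys"
proof -
  have t_mult: "t a b * t c d = t (a * c) (b * d)" for a b c d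
    using t by (simp add: minimal_tensor_product_def)
  have single: "tensor_sum t (alg_mult [p] ys) = tensor_sum t [p] * tensor_sum t ys" for p
    by (induction ys) (auto simp: tensor_sum_def alg_mult_def t_mult distrib_left case_prod_unfold)
  show ?thesis
  proof (induction xs)
    case (Cons p xs)
    have "alg_mult (p # xs) ys = alg_mult [p] ys @ alg_mult xs ys" "p # xs = [p] @ xs"
      by (auto simp: alg_mult_def)
    then show ?case using Cons single by (simp only: tensor_sum_append distrib_right)
  qed (simp add: tensor_sum_def alg_mult_def)
qed

lemma subspace_tensor_sum: "subspace (range (tensor_sum t))"
proof (rule subspaceI)
  show "0 \<in> range (tensor_sum t)"
    by (rule range_eqI[of _ _ "[]"]) (simp add: tensor_sum_def)
  show "x + y \<in> range (tensor_sum t)" if "x \<in> range (tensor_sum t)" "y \<in> range (tensor_sum t)" for x y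
    using that by (auto simp flip: tensor_sum_append)
  show "c *\<^sub>R x \<in> range (tensor_sum t)" if "x \<in> range (tensor_sum t)" for x c
    using that by (auto simp: scaleR_scaleC simp flip: tensor_sum_scale)
qed

lemma dense_tensor_sum: "closure (range (tensor_sum t)) = UNIV"
proof -
  have "t a b \<in> range (tensor_sum t)" for a b
    by (rule range_eqI[of _ _ "[(a, b)]"]) (simp add: tensor_sum_def)
  then have "span {t a b | a b. True} \<subseteq> range (tensor_sum t)"
    by (intro span_minimal subspace_tensor_sum) blast
  from closure_mono[OF this] show ?thesis
    unfolding dense_elementary_tensors by blast
qed

context
  fixes \<phi> :: "'a \<Rightarrow>\<^sub>L complex" and \<psi> :: "'b \<Rightarrow>\<^sub>L complex"
  assumes states: "state \<phi>" "state \<psi>"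
begin

lemma tensor_functional_exists: "\<exists>F :: 'c \<Rightarrow>\<^sub>L complex. \<forall>a b. F (t a b) = \<phi> a * \<psi> b"
proof -
  let ?T = "tensor_sum t"
  define A where "A = alg_functional \<phi> \<psi>"
  define f where "f z = A (SOME xs. ?T xs = z)" for z
  have A_append: "A (xs @ ys) = A xs + A ys" for xs ys
    by (simp add: A_def alg_functional_append)
  have A_scale: "A (tensor_scale c xs) = c * A xs" for c xs
    unfolding A_def by (rule alg_functional_scale[OF states])
  have bound: "cmod (A xs) \<le> norm (?T xs)" for xs
    using t alg_functional_le_spatial_norm[OF states, of xs]
    by (simp add: minimal_tensor_product_def A_def tensor_sum_def)
  \<comment> \<open>Appending the negative of \<open>ys\<close> to \<open>xs\<close> represents 0,
    on which \<open>A\<close> vanishes by the norm bound. Hence the choice of representative in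
    \<open>f\<close> does not matter.\<close>
  have A_cong: "A xs = A ys" if "?T xs = ?T ys" for xs ys
    using bound[of "xs @ tensor_scale (-1) ys"] that
    by (simp add: tensor_sum_append tensor_sum_scale A_append A_scale scaleC_minus1)
  have f_T: "f (?T xs) = A xs" for xs
    unfolding f_def by (rule A_cong, rule someI) (rule refl)
  obtain F :: "'c \<Rightarrow>\<^sub>L complex" where F: "\<And>x. x \<in> range ?T \<Longrightarrow> F x = f x"
    using subspace_tensor_sum dense_tensor_sum
  proof (rule blinfun_extension_dense)
    show "f (x + y) = f x + f y" if "x \<in> range ?T" "y \<in> range ?T" for x y
      using that by (auto simp: f_T A_append simp flip: tensor_sum_append)
    show "f (r *\<^sub>R x) = r *\<^sub>R f x" if "x \<in> range ?T" for r x
      using that by (auto simp: f_T A_scale scaleR_scaleC scaleR_conv_of_real simp flip: tensor_sum_scale)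
    show "norm (f x) \<le> norm x * 1" if "x \<in> range ?T" for x
      using that bound by (auto simp: f_T)
  qed (rule that)
  have "F (t a b) = \<phi> a * \<psi> b" for a b
    using F[OF rangeI, of "[(a, b)]"] f_T[of "[(a, b)]"] by (simp add: tensor_sum_def A_def alg_functional_def)
  then show ?thesis by blast
qed

lemma tensor_functional_apply: "tensor_functional t \<phi> \<psi> (t a b) = \<phi> a * \<psi> b"
proof -
  have "\<exists>!F. \<forall>a b. blinfun_apply F (t a b) = \<phi> a * \<psi> b"
  proof (rule ex_ex1I[OF tensor_functional_exists])
    fix F G :: "'c \<Rightarrow>\<^sub>L complex"
    assume "\<forall>a b. F (t a b) = \<phi> a * \<psi> b" "\<forall>a b. G (t a b) = \<phi> a * \<psi> b"
    then show "F = G" by (intro blinfun_eqI_dense[OF dense_elementary_tensors]) auto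
  qed
  from theI'[OF this] show ?thesis
    unfolding tensor_functional_def by blast
qed

text \<open>Complex homogeneity and positivity hold on algebraic tensors and survive limits, because
  the functional is continuous and the conditions are closed.\<close>

lemma positive_functional_tensor: "positive_functional (tensor_functional t \<phi> \<psi>)"
proof -
  define F where "F = blinfun_apply (tensor_functional t \<phi> \<psi>)"
  have contF: "continuous_on UNIV F"
    unfolding F_def by (intro linear_continuous_on blinfun.bounded_linear_right)
  have F_T: "F (tensor_sum t xs) = alg_functional \<phi> \<psi> xs" for xs
    by (induction xs)
       (auto simp: tensor_sum_def alg_functional_def F_def blinfun.add_right tensor_functional_apply)
  have scale: "F (c *\<^sub>C x) = c * F x" for c x
  proof (rule closure_UNIV_induct[OF dense_tensor_sum])
    have "bounded_linear (\<lambda>x::'c. c *\<^sub>C x)"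
      by (rule bounded_linear_intro[of _ "cmod c"])
         (auto simp: scaleC_add_right norm_scaleC scaleR_scaleC scaleC_scaleC mult.commute)
    then have "continuous_on UNIV (\<lambda>x::'c. c *\<^sub>C x)" by (rule linear_continuous_on)
    then have "continuous_on UNIV (\<lambda>x. F (c *\<^sub>C x))"
      by (rule continuous_on_compose2[OF contF]) auto
    then show "closed {x. F (c *\<^sub>C x) = c * F x}"
      by (intro closed_Collect_eq continuous_intros contF)
    show "F (c *\<^sub>C x) = c * F x" if "x \<in> range (tensor_sum t)" for x
      using that alg_functional_scale[OF states] by (auto simp: F_T simp flip: tensor_sum_scale)
  qed
  have nonneg: "F (star x * x) \<in> \<real>\<^sub>\<ge>\<^sub>0" for x
  proof (rule closure_UNIV_induct[OF dense_tensor_sum, where P = "\<lambda>x. F (star x * x) \<in> \<real>\<^sub>\<ge>\<^sub>0"])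
    have "continuous_on UNIV (\<lambda>x::'c. star x * x)"
      by (intro continuous_intros linear_continuous_on[OF bounded_linear_star])
    then have "continuous_on UNIV (\<lambda>x. F (star x * x))"
      by (rule continuous_on_compose2[OF contF]) auto
    then have "closed ((\<lambda>x. F (star x * x)) -` \<real>\<^sub>\<ge>\<^sub>0)"
      by (intro closed_vimage) auto
    then show "closed {x. F (star x * x) \<in> \<real>\<^sub>\<ge>\<^sub>0}"
      by (simp add: vimage_def)
    show "F (star x * x) \<in> \<real>\<^sub>\<ge>\<^sub>0" if "x \<in> range (tensor_sum t)" for x
      using that alg_functional_square_nonneg(1)[OF states]
      by (auto simp: F_T simp flip: tensor_sum_star tensor_sum_mult)
  qed
  show ?thesis
    unfolding positive_functional_def using scale nonneg
    by (auto simp: F_def blinfun.add_right)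
qed

end

end

text \<open>
  A *-homomorphism is not assumed to be bounded, but its composition with a positive functional is
  positive and hence bounded.
\<close>

lemma convolution_apply:
  assumes "minimal_tensor_product t" "star_hom \<Delta>" "state \<phi>" "state \<psi>"
  shows "convolution t \<Delta> \<phi> \<psi> x = tensor_functional t \<phi> \<psi> (\<Delta> x)"
proof -
  have "positive_functional (\<lambda>x. tensor_functional t \<phi> \<psi> (\<Delta> x))"
    using positive_functional_tensor[of t \<phi> \<psi>] assms
    by (simp add: positive_functional_def star_hom_def clinear_def)
  then show ?thesis
    unfolding convolution_def
    by (simp add: positive_functional_bounded_linear bounded_linear_Blinfun_apply)
qed


section \<open>Words in the entries of a magic unitary\<close>

text \<open>For index lists of equal length \<open>k\<close> this is an entry of the
  \<open>k\<close>-th tensor power of \<open>u\<close>; surplus indices of the longer list are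
  ignored.\<close>

fun word :: "(nat \<Rightarrow> nat \<Rightarrow> 'a::monoid_mult) \<Rightarrow> nat list \<Rightarrow> nat list \<Rightarrow> 'a" where
  "word u (i # I) (j # J) = u i j * word u I J"
| "word u _ _ = 1"

definition multi_indices :: "nat \<Rightarrow> nat \<Rightarrow> nat list set" where
  "multi_indices N k = {I. set I \<subseteq> {..<N} \<and> length I = k}"

lemma finite_multi_indices [simp]: "finite (multi_indices N k)"
  unfolding multi_indices_def by (rule finite_lists_length_eq) simp

lemma multi_indices_0 [simp]: "multi_indices N 0 = {[]}"
  by (auto simp: multi_indices_def)

lemma multi_indices_Suc: "multi_indices N (Suc k) = (\<lambda>(i, I). i # I) ` ({..<N} \<times> multi_indices N k)"
  by (auto simp: multi_indices_def length_Suc_conv image_iff)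

lemma Cons_multi_indices [simp]:
  "i # I \<in> multi_indices N (Suc k) \<longleftrightarrow> i < N \<and> I \<in> multi_indices N k"
  by (auto simp: multi_indices_def)

lemma multi_indices_SucE:
  assumes "I \<in> multi_indices N (Suc k)"
  obtains i I' where "I = i # I'" "i < N" "I' \<in> multi_indices N k"
  using assms by (auto simp: multi_indices_Suc)

lemma sum_multi_indices_Suc:
  "(\<Sum>I\<in>multi_indices N (Suc k). f I) = (\<Sum>i<N. \<Sum>I\<in>multi_indices N k. f (i # I))"
proof -
  have "inj_on (\<lambda>(i, I). i # I) ({..<N} \<times> multi_indices N k)"
    by (auto simp: inj_on_def)
  then show ?thesis
    unfolding multi_indices_Suc by (simp add: sum.reindex sum.cartesian_product case_prod_unfold)
qed

lemma word_append: "length I = length J \<Longrightarrow> word u (I @ I') (J @ J') = word u I J * word u I' J'"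
  by (induction I J rule: list_induct2) (auto simp: mult.assoc)

lemma star_word:
  assumes "\<And>i j. i < N \<Longrightarrow> j < N \<Longrightarrow> star (u i j) = u i j"
    and "I \<in> multi_indices N k" "J \<in> multi_indices N k"
  shows "star (word u I J) = word u (rev I) (rev J)"
  using assms(2,3)
proof (induction k arbitrary: I J)
  case (Suc k)
  from Suc.prems obtain i I' j J' where *: "I = i # I'" "J = j # J'"
      "i < N" "j < N" "I' \<in> multi_indices N k" "J' \<in> multi_indices N k"
    by (elim multi_indices_SucE) blast
  then have "length (rev I') = length (rev J')" by (simp add: multi_indices_def)
  with * show ?case by (simp add: star_mult Suc.IH assms(1) word_append)
qed simp

text \<open>If \<open>Z\<close> is a coisometry under \<open>f\<close>, its image under
  \<open>f\<close> is a contraction acting on row vectors: Cauchy-Schwarz bounds the square of each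
  value \<open>f (z j)\<close> by \<open>f (z j * star (z j))\<close>, and summing over
  \<open>j\<close> leaves only the diagonal terms.\<close>

lemma positive_functional_contraction:
  assumes f: "positive_functional f" "f 1 = 1" and "finite I"
    and Z: "\<And>l l'. l \<in> I \<Longrightarrow> l' \<in> I \<Longrightarrow> (\<Sum>j\<in>J. f (Z l j * star (Z l' j))) = (if l = l' then 1 else 0)"
  shows "(\<Sum>j\<in>J. (cmod (\<Sum>l\<in>I. a l * f (Z l j)))\<^sup>2) \<le> (\<Sum>l\<in>I. (cmod (a l))\<^sup>2)"
proof -
  note s = positive_functional_simps[OF f(1)] positive_functional_sum[OF f(1)]
  define z where "z j = (\<Sum>l\<in>I. a l *\<^sub>C Z l j)" for j
  have "(cmod (\<Sum>l\<in>I. a l * f (Z l j)))\<^sup>2 \<le> Re (f (z j * star (z j)))" for j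
    using positive_functional_Cauchy_Schwarz[OF f(1), of "star (z j)" 1]
    by (simp add: star_star f(2)) (simp add: z_def s)
  then have "(\<Sum>j\<in>J. (cmod (\<Sum>l\<in>I. a l * f (Z l j)))\<^sup>2) \<le> (\<Sum>j\<in>J. Re (f (z j * star (z j))))"
    by (rule sum_mono)
  also have "\<dots> = Re (\<Sum>j\<in>J. f (z j * star (z j)))" by (rule Re_sum[symmetric])
  also have "(\<Sum>j\<in>J. f (z j * star (z j))) =
      (\<Sum>j\<in>J. \<Sum>l\<in>I. \<Sum>l'\<in>I. a l * cnj (a l') * f (Z l j * star (Z l' j)))"
    by (simp add: z_def star_sum star_scaleC sum_product mult_scaleC_left mult_scaleC_right
        scaleC_scaleC s mult.commute)
  also have "\<dots> = (\<Sum>l\<in>I. \<Sum>l'\<in>I. \<Sum>j\<in>J. a l * cnj (a l') * f (Z l j * star (Z l' j)))"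
    by (subst sum.swap, rule sum.cong[OF refl], subst sum.swap) (rule refl)
  also have "\<dots> = (\<Sum>l\<in>I. \<Sum>l'\<in>I. a l * cnj (a l') * (if l = l' then 1 else 0))"
    unfolding sum_distrib_left[symmetric] by (intro sum.cong refl) (simp add: Z)
  also have "\<dots> = (\<Sum>l\<in>I. a l * cnj (a l))"
    using \<open>finite I\<close> by (simp add: if_distrib cong: if_cong)
  also have "Re \<dots> = (\<Sum>l\<in>I. (cmod (a l))\<^sup>2)"
    by (simp flip: complex_norm_square)
  finally show ?thesis .
qed

section \<open>Unitarity of the tensor powers of a magic unitary\<close>

context
  fixes N :: nat and u :: "nat \<Rightarrow> nat \<Rightarrow> 'a::cstar_algebra" and f :: "'a \<Rightarrow> complex"
  assumes u: "magic_unitary N u" and f: "positive_functional f"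
begin

lemma magic_unitary_entry:
  "i < N \<Longrightarrow> j < N \<Longrightarrow> star (u i j) = u i j" "i < N \<Longrightarrow> j < N \<Longrightarrow> u i j * u i j = u i j"
  using u by (auto simp: magic_unitary_def projection_def)

lemma magic_unitary_row_orthogonal:
  assumes "i < N" "j < N" "j' < N" "j \<noteq> j'"
  shows "f (w * (u i j * u i j') * y) = 0"
  by (rule positive_functional_projections_orthogonal[OF f, of "{..<N}" "\<lambda>j. u i j"])
     (use u assms in \<open>auto simp: magic_unitary_def\<close>)

lemma magic_unitary_column_orthogonal:
  assumes "i < N" "i' < N" "j < N" "i \<noteq> i'"
  shows "f (w * (u i j * u i' j) * y) = 0"
  by (rule positive_functional_projections_orthogonal[OF f, of "{..<N}" "\<lambda>i. u i j"])
     (use u assms in \<open>auto simp: magic_unitary_def\<close>)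

text \<open>In \<open>star (word u I J) * word u I J'\<close> the first letters meet in the middle.
  Summing over their common row index removes them and leaves the context \<open>w\<close>,
  \<open>y\<close> unchanged.\<close>

lemma word_isometry:
  assumes "J \<in> multi_indices N k" "J' \<in> multi_indices N k"
  shows "(\<Sum>I\<in>multi_indices N k. f (w * (star (word u I J) * word u I J') * y)) =
    (if J = J' then f (w * y) else 0)"
  using assms
proof (induction k arbitrary: J J')
  case (Suc k)
  from Suc.prems obtain j K j' K' where *: "J = j # K" "J' = j' # K'"
      "j < N" "j' < N" "K \<in> multi_indices N k" "K' \<in> multi_indices N k"
    by (elim multi_indices_SucE) blast
  have "(\<Sum>I\<in>multi_indices N (Suc k). f (w * (star (word u I J) * word u I J') * y)) =
      (\<Sum>I\<in>multi_indices N k. \<Sum>i<N. f ((w * star (word u I K)) * (u i j * u i j') * (word u I K' * y)))"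
    unfolding sum_multi_indices_Suc *
    by (subst sum.swap, intro sum.cong refl)
       (use * in \<open>simp add: star_mult magic_unitary_entry(1) mult.assoc\<close>)
  also have "\<dots> = (if J = J' then f (w * y) else 0)"
  proof (cases "j = j'")
    case True
    have "(\<Sum>i<N. f ((w * star (word u I K)) * (u i j * u i j') * (word u I K' * y))) =
        f (w * (star (word u I K) * word u I K') * y)" for I
    proof -
      have "(\<Sum>i<N. f ((w * star (word u I K)) * (u i j * u i j') * (word u I K' * y))) =
          f ((w * star (word u I K)) * (\<Sum>i<N. u i j) * (word u I K' * y))"
        unfolding sum_distrib_left sum_distrib_right positive_functional_sum[OF f]
        using True * by (intro sum.cong refl) (simp add: magic_unitary_entry(2))
      also have "(\<Sum>i<N. u i j) = 1" using u * by (simp add: magic_unitary_def)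
      finally show ?thesis by (simp add: mult.assoc)
    qed
    then show ?thesis using Suc.IH[of K K'] True * by simp
  next
    case False
    then show ?thesis
      using * magic_unitary_row_orthogonal by (simp add: sum.neutral)
  qed
  finally show ?case .
qed simp

text \<open>Here the first letters are outermost, so the induction removes the inner words first and
  moves the first letters into the context; hence \<open>w\<close> and \<open>y\<close> are
  generalised.\<close>

lemma word_coisometry:
  assumes "I \<in> multi_indices N k" "I' \<in> multi_indices N k"
  shows "(\<Sum>J\<in>multi_indices N k. f (w * (word u I J * star (word u I' J)) * y)) =
    (if I = I' then f (w * y) else 0)"
  using assms
proof (induction k arbitrary: I I' w y)
  case (Suc k)
  from Suc.prems obtain i K i' K' where *: "I = i # K" "I' = i' # K'"
      "i < N" "i' < N" "K \<in> multi_indices N k" "K' \<in> multi_indices N k"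
    by (elim multi_indices_SucE) blast
  have "(\<Sum>J\<in>multi_indices N (Suc k). f (w * (word u I J * star (word u I' J)) * y)) =
      (\<Sum>j<N. \<Sum>J\<in>multi_indices N k. f ((w * u i j) * (word u K J * star (word u K' J)) * (u i' j * y)))"
    unfolding sum_multi_indices_Suc *
    by (intro sum.cong refl) (use * in \<open>simp add: star_mult magic_unitary_entry(1) mult.assoc\<close>)
  also have "\<dots> = (\<Sum>j<N. if K = K' then f ((w * u i j) * (u i' j * y)) else 0)"
    using Suc.IH * by simp
  also have "\<dots> = (if I = I' then f (w * y) else 0)"
  proof (cases "i = i'")
    case True
    have "(\<Sum>j<N. f ((w * u i j) * (u i' j * y))) = f (w * (\<Sum>j<N. u i j) * y)"
      unfolding sum_distrib_left sum_distrib_right positive_functional_sum[OF f]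
    proof (intro sum.cong refl)
      fix j assume "j \<in> {..<N}"
      then have "u i j * u i j = u i j" using * by (simp add: magic_unitary_entry(2))
      then have "(w * u i j) * (u i' j * y) = w * u i j * y"
        unfolding True[symmetric] by (metis mult.assoc)
      then show "f ((w * u i j) * (u i' j * y)) = f (w * u i j * y)" by simp
    qed
    also have "(\<Sum>j<N. u i j) = 1" using u * by (simp add: magic_unitary_def)
    finally show ?thesis using True * by simp
  next
    case False
    have "f ((w * u i j) * (u i' j * y)) = 0" if "j < N" for j
      using magic_unitary_column_orthogonal[of i i' j w y] False * that by (simp add: mult.assoc)
    then show ?thesis using False * by (auto intro!: sum.neutral)
  qed
  finally show ?case .
qed simp

end

section \<open>Hilbert-Schmidt energies, taken as squared norms\<close>

definition word_energy ::
    "nat \<Rightarrow> (nat \<Rightarrow> nat \<Rightarrow> 'a::cstar_algebra) \<Rightarrow> nat \<Rightarrow> ('a \<Rightarrow>\<^sub>L complex) \<Rightarrow> real" where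
  "word_energy N u k \<phi> =
     (\<Sum>I\<in>multi_indices N k. \<Sum>J\<in>multi_indices N k. (cmod (\<phi> (word u I J)))\<^sup>2)"

lemma word_energy_nonneg: "0 \<le> word_energy N u k \<phi>"
  by (simp add: word_energy_def sum_nonneg)

text \<open>A single entry is bounded by the energy of the difference. The parallelogram law trades
  that energy for the one of the midpoint, which stays in a convex set.\<close>

lemma word_energy_parallelogram:
  fixes \<phi> \<psi> :: "'a::cstar_algebra \<Rightarrow>\<^sub>L complex"
  assumes "I \<in> multi_indices N k" "J \<in> multi_indices N k"
  shows "(cmod (\<phi> (word u I J) - \<psi> (word u I J)))\<^sup>2 \<le> 2 * word_energy N u k \<phi> + 2 * word_energy N u k \<psi>
    - 4 * word_energy N u k ((1/2) *\<^sub>R \<phi> + (1/2) *\<^sub>R \<psi>)"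
proof -
  let ?M = "multi_indices N k"
  have *: "(cmod (a - b))\<^sup>2 = 2 * (cmod a)\<^sup>2 + 2 * (cmod b)\<^sup>2 - 4 * (cmod ((1/2) *\<^sub>R a + (1/2) *\<^sub>R b))\<^sup>2" for a b
    unfolding cmod_power2 by (simp add: power2_eq_square field_simps)
  have "(cmod (\<phi> (word u I J) - \<psi> (word u I J)))\<^sup>2 \<le> (\<Sum>J\<in>?M. (cmod (\<phi> (word u I J) - \<psi> (word u I J)))\<^sup>2)"
    using assms by (intro member_le_sum) auto
  also have "\<dots> \<le> (\<Sum>I\<in>?M. \<Sum>J\<in>?M. (cmod (\<phi> (word u I J) - \<psi> (word u I J)))\<^sup>2)"
    using assms by (intro member_le_sum[of I]) (auto intro: sum_nonneg)
  also have "\<dots> = 2 * word_energy N u k \<phi> + 2 * word_energy N u k \<psi>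
    - 4 * word_energy N u k ((1/2) *\<^sub>R \<phi> + (1/2) *\<^sub>R \<psi>)"
    unfolding * word_energy_def blinfun.add_left blinfun.scaleR_left
    by (simp only: sum.distrib sum_subtractf sum_distrib_left)
  finally show ?thesis .
qed

section \<open>Convolution on words and near-minimisers in a Pal set\<close>

context quantum_permutation_group
begin

text \<open>Multiplicativity of \<open>\<Delta>\<close> makes every tensor power of \<open>u\<close>
  a corepresentation.\<close>

lemma comult_word:
  assumes "I \<in> multi_indices N k" "J \<in> multi_indices N k"
  shows "\<Delta> (word u I J) = (\<Sum>K\<in>multi_indices N k. t (word u I K) (word u K J))"
  using assms
proof (induction k arbitrary: I J)
  case 0
  then show ?case
    using comult_hom tensor by (simp add: star_hom_def minimal_tensor_product_def)
next
  case (Suc k)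
  from Suc.prems obtain i I' j J' where *: "I = i # I'" "J = j # J'"
      "i < N" "j < N" "I' \<in> multi_indices N k" "J' \<in> multi_indices N k"
    by (elim multi_indices_SucE) blast
  have t_mult: "t a b * t c d = t (a * c) (b * d)" for a b c d
    using tensor by (simp add: minimal_tensor_product_def)
  have "\<Delta> (word u I J) = \<Delta> (u i j) * \<Delta> (word u I' J')"
    using comult_hom * by (simp add: star_hom_def)
  also have "\<dots> = (\<Sum>l<N. \<Sum>K\<in>multi_indices N k. t (u i l) (u l j) * t (word u I' K) (word u K J'))"
    using * by (simp add: comult_entry Suc.IH sum_product)
  also have "\<dots> = (\<Sum>K\<in>multi_indices N (Suc k). t (word u I K) (word u K J))"
    by (simp add: sum_multi_indices_Suc t_mult *)
  finally show ?case .
qed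

lemma convolution_word:
  assumes "state \<phi>" "state \<psi>" "I \<in> multi_indices N k" "J \<in> multi_indices N k"
  shows "convolution t \<Delta> \<phi> \<psi> (word u I J) =
    (\<Sum>K\<in>multi_indices N k. \<phi> (word u I K) * \<psi> (word u K J))"
  unfolding convolution_apply[OF tensor comult_hom assms(1,2)] comult_word[OF assms(3,4)] blinfun.sum_right
  by (intro sum.cong refl tensor_functional_apply tensor assms)

text \<open>The matrix of \<psi> contracts each row of the matrix of \<phi>, by the coisometry
  relation; the matrix of \<phi> contracts each column of the matrix of \<psi>, by the isometry
  relation.\<close>

lemma word_energy_convolution_le:
  assumes "state \<phi>" "state \<psi>"
  shows "word_energy N u k (convolution t \<Delta> \<phi> \<psi>) \<le> word_energy N u k \<phi>"
    and "word_energy N u k (convolution t \<Delta> \<phi> \<psi>) \<le> word_energy N u k \<psi>"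
proof -
  let ?M = "multi_indices N k" and ?W = "word u"
  note \<phi> = positive_functional_blinfun[OF assms(1)] state_one[OF assms(1)]
  note \<psi> = positive_functional_blinfun[OF assms(2)] state_one[OF assms(2)]
  have eq: "word_energy N u k (convolution t \<Delta> \<phi> \<psi>) =
      (\<Sum>I\<in>?M. \<Sum>J\<in>?M. (cmod (\<Sum>K\<in>?M. \<phi> (?W I K) * \<psi> (?W K J)))\<^sup>2)"
    unfolding word_energy_def by (intro sum.cong refl) (simp add: convolution_word assms)
  have "(\<Sum>J\<in>?M. (cmod (\<Sum>K\<in>?M. \<phi> (?W I K) * \<psi> (?W K J)))\<^sup>2) \<le> (\<Sum>K\<in>?M. (cmod (\<phi> (?W I K)))\<^sup>2)" for I
  proof (rule positive_functional_contraction[OF \<psi> finite_multi_indices])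
    show "(\<Sum>J\<in>?M. \<psi> (?W K J * star (?W K' J))) = (if K = K' then 1 else 0)"
      if "K \<in> ?M" "K' \<in> ?M" for K K'
      using word_coisometry[OF magic \<psi>(1) that, of 1 1] \<psi>(2) by simp
  qed
  then show "word_energy N u k (convolution t \<Delta> \<phi> \<psi>) \<le> word_energy N u k \<phi>"
    unfolding eq unfolding word_energy_def by (rule sum_mono)
  have "(\<Sum>I\<in>?M. (cmod (\<Sum>K\<in>?M. \<phi> (?W I K) * \<psi> (?W K J)))\<^sup>2) \<le> (\<Sum>K\<in>?M. (cmod (\<psi> (?W K J)))\<^sup>2)" for J
  proof -
    \<comment> \<open>Complex conjugation turns the action on columns into one on rows, with the
      coisometry \<open>star (word u I K)\<close> whose row index is \<open>K\<close> and whose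
      column index is \<open>I\<close>.\<close>
    have "(\<Sum>I\<in>?M. (cmod (\<Sum>K\<in>?M. cnj (\<psi> (?W K J)) * \<phi> (star (?W I K))))\<^sup>2)
        \<le> (\<Sum>K\<in>?M. (cmod (cnj (\<psi> (?W K J))))\<^sup>2)"
    proof (rule positive_functional_contraction[OF \<phi> finite_multi_indices])
      show "(\<Sum>I\<in>?M. \<phi> (star (?W I K) * star (star (?W I K')))) = (if K = K' then 1 else 0)"
        if "K \<in> ?M" "K' \<in> ?M" for K K'
        using word_isometry[OF magic \<phi>(1) that, of 1 1] \<phi>(2) by (simp add: star_star)
    qed
    moreover have "cmod (\<Sum>K\<in>?M. cnj (\<psi> (?W K J)) * \<phi> (star (?W I K))) =
        cmod (\<Sum>K\<in>?M. \<phi> (?W I K) * \<psi> (?W K J))" for I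
      unfolding positive_functional_star[OF \<phi>(1)] complex_cnj_mult[symmetric] cnj_sum[symmetric]
        complex_mod_cnj by (simp only: mult.commute)
    ultimately show ?thesis by simp
  qed
  then have "(\<Sum>J\<in>?M. \<Sum>I\<in>?M. (cmod (\<Sum>K\<in>?M. \<phi> (?W I K) * \<psi> (?W K J)))\<^sup>2)
      \<le> (\<Sum>J\<in>?M. \<Sum>K\<in>?M. (cmod (\<psi> (?W K J)))\<^sup>2)"
    by (rule sum_mono)
  also have "\<dots> = word_energy N u k \<psi>"
    unfolding word_energy_def by (rule sum.swap)
  finally show "word_energy N u k (convolution t \<Delta> \<phi> \<psi>) \<le> word_energy N u k \<psi>"
    unfolding eq by (subst sum.swap)
qed

text \<open>Complex multiples are included so that the real \<open>span\<close> is a complex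
  subspace.\<close>

definition words :: "'a set" where
  "words = {c *\<^sub>C word u I J | c I J k. I \<in> multi_indices N k \<and> J \<in> multi_indices N k}"

text \<open>Products of words are concatenations and adjoints are reversals. The span therefore
  contains the whole coefficient algebra.\<close>

lemma star_subalgebra_span_words: "star_subalgebra (span words)"
proof -
  have scale: "c *\<^sub>C x \<in> span words" if "x \<in> span words" for c x
    using that
  proof (induction rule: span_induct_alt)
    case (step r x y)
    from \<open>x \<in> words\<close> obtain d I J k where x: "x = d *\<^sub>C word u I J"
      "I \<in> multi_indices N k" "J \<in> multi_indices N k" by (auto simp: words_def)
    have "c *\<^sub>C x \<in> words"
      unfolding x words_def scaleC_scaleC using x by blast
    moreover have "c *\<^sub>C (r *\<^sub>R x + y) = r *\<^sub>R (c *\<^sub>C x) + c *\<^sub>C y"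
      by (simp add: scaleC_add_right scaleR_scaleC scaleC_scaleC mult.commute)
    ultimately show ?case
      using step.IH by (simp add: span_add span_base span_scale)
  qed (simp add: span_zero)
  have star: "star x \<in> span words" if "x \<in> span words" for x
    using that
  proof (induction rule: span_induct_alt)
    case (step r x y)
    from \<open>x \<in> words\<close> obtain d I J k where x: "x = d *\<^sub>C word u I J"
      "I \<in> multi_indices N k" "J \<in> multi_indices N k" by (auto simp: words_def)
    have "star x = cnj d *\<^sub>C word u (rev I) (rev J)"
      unfolding x(1) star_scaleC
      by (subst star_word[OF _ x(2,3)]) (use magic in \<open>auto simp: magic_unitary_def projection_def\<close>)
    moreover have "rev I \<in> multi_indices N k" "rev J \<in> multi_indices N k"
      using x by (auto simp: multi_indices_def)
    ultimately have "star x \<in> words" unfolding words_def by blast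
    then show ?case
      using step.IH by (simp add: star_add star_scaleR span_add span_base span_scale)
  qed (simp add: span_zero)
  have word_mult: "x * y \<in> words" if "x \<in> words" "y \<in> words" for x y
  proof -
    from \<open>x \<in> words\<close> obtain d I J k where x: "x = d *\<^sub>C word u I J"
      "I \<in> multi_indices N k" "J \<in> multi_indices N k" by (auto simp: words_def)
    from \<open>y \<in> words\<close> obtain e I' J' k' where y: "y = e *\<^sub>C word u I' J'"
      "I' \<in> multi_indices N k'" "J' \<in> multi_indices N k'" by (auto simp: words_def)
    have "x * y = (d * e) *\<^sub>C word u (I @ I') (J @ J')"
      using x y
      by (simp add: word_append multi_indices_def mult_scaleC_left mult_scaleC_right scaleC_scaleC mult.commute[of e])
    moreover have "I @ I' \<in> multi_indices N (k + k')" "J @ J' \<in> multi_indices N (k + k')"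
      using x y by (auto simp: multi_indices_def)
    ultimately show ?thesis unfolding words_def by blast
  qed
  have mult1: "x * y \<in> span words" if "x \<in> words" "y \<in> span words" for x y
    using that(2)
  proof (induction rule: span_induct_alt)
    case (step r z y)
    then show ?case
      using word_mult[OF that(1), of z] by (simp add: distrib_left span_add span_base span_scale)
  qed (simp add: span_zero)
  have mult: "x * y \<in> span words" if "x \<in> span words" "y \<in> span words" for x y
    using that(1)
  proof (induction rule: span_induct_alt)
    case (step r z x)
    then show ?case
      using mult1[OF _ that(2), of z] by (simp add: distrib_right span_add span_scale)
  qed (simp add: span_zero)
  show ?thesis
    unfolding star_subalgebra_def using scale star mult by (auto simp: span_zero span_add)
qed

lemma dense_words: "closure (span words) = UNIV"
proof -
  have "coefficient_algebra N u \<subseteq> span words"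
    unfolding coefficient_algebra_def
  proof (rule hull_minimal, clarify)
    show "star_subalgebra (span words)" by (rule star_subalgebra_span_words)
  next
    fix i j assume "i < N" "j < N"
    then have "1 *\<^sub>C word u [i] [j] \<in> words"
      unfolding words_def by (intro CollectI exI[of _ 1] exI[of _ "[i]"] exI[of _ "[j]"]) auto
    then show "u i j \<in> span words" by (simp add: span_base)
  qed
  then show ?thesis
    using closure_mono universal unfolding universal_completion_of_def by blast
qed

lemma state_eqI_words:
  fixes \<phi> \<psi> :: "'a \<Rightarrow>\<^sub>L complex"
  assumes "state \<phi>" "state \<psi>"
    and "\<And>k I J. I \<in> multi_indices N k \<Longrightarrow> J \<in> multi_indices N k \<Longrightarrow> \<phi> (word u I J) = \<psi> (word u I J)"
  shows "\<phi> = \<psi>"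
proof (rule blinfun_eqI_dense[OF dense_words])
  fix x assume "x \<in> words"
  then show "\<phi> x = \<psi> x"
    using assms by (auto simp: words_def state_def)
qed

text \<open>
  A product of elements of \<open>S\<close> that nearly minimise the energy for one word length each nearly
  minimises all of them.
\<close>

lemma pal_set_simultaneous_minimiser:
  assumes S: "pal_set t \<Delta> S" and "0 < e"
  shows "\<exists>\<phi>\<in>S. \<forall>k<n. word_energy N u k \<phi> \<le> (INF \<rho>\<in>S. word_energy N u k \<rho>) + e"
proof (induction n)
  case 0
  then show ?case using S by (auto simp: pal_set_def)
next
  case (Suc n)
  then obtain \<phi> where \<phi>: "\<phi> \<in> S" "\<And>k. k < n \<Longrightarrow> word_energy N u k \<phi> \<le> (INF \<rho>\<in>S. word_energy N u k \<rho>) + e"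
    by blast
  have "\<exists>x\<in>word_energy N u n ` S. x < (INF \<rho>\<in>S. word_energy N u n \<rho>) + e"
    using S \<open>0 < e\<close> by (intro cInf_lessD) (auto simp: pal_set_def)
  then obtain \<psi> where \<psi>: "\<psi> \<in> S" "word_energy N u n \<psi> \<le> (INF \<rho>\<in>S. word_energy N u n \<rho>) + e"
    by force
  have st: "state \<phi>" "state \<psi>" using S \<phi> \<psi> by (auto simp: pal_set_def)
  show ?case
  proof (intro bexI allI impI)
    show "convolution t \<Delta> \<phi> \<psi> \<in> S" using S \<phi> \<psi> by (auto simp: pal_set_def)
    show "word_energy N u k (convolution t \<Delta> \<phi> \<psi>) \<le> (INF \<rho>\<in>S. word_energy N u k \<rho>) + e" if "k < Suc n" for k
    proof (cases "k = n")
      case True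
      then show ?thesis using word_energy_convolution_le(2)[OF st, of n] \<psi>(2) by simp
    next
      case False
      then show ?thesis using word_energy_convolution_le(1)[OF st, of k] \<phi>(2)[of k] that by simp
    qed
  qed
qed

text \<open>With \<open>m\<close> the infimum, the midpoint lies in \<open>S\<close> and has energy
  at least \<open>m\<close>, so the parallelogram bound is at most 2(m + e) + 2(m + e) - 4m =
  4e.\<close>

lemma near_minimisers_close:
  fixes \<phi> \<psi> :: "'a \<Rightarrow>\<^sub>L complex"
  assumes S: "pal_set t \<Delta> S" and "\<phi> \<in> S" "\<psi> \<in> S"
    and "word_energy N u k \<phi> \<le> (INF \<rho>\<in>S. word_energy N u k \<rho>) + e"
    and "word_energy N u k \<psi> \<le> (INF \<rho>\<in>S. word_energy N u k \<rho>) + e"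
    and "I \<in> multi_indices N k" "J \<in> multi_indices N k"
  shows "(cmod (\<phi> (word u I J) - \<psi> (word u I J)))\<^sup>2 \<le> 4 * e"
proof -
  have "(1/2) *\<^sub>R \<phi> + (1/2) *\<^sub>R \<psi> \<in> S"
    using S assms(2,3) by (intro convexD) (auto simp: pal_set_def)
  then have "(INF \<rho>\<in>S. word_energy N u k \<rho>) \<le> word_energy N u k ((1/2) *\<^sub>R \<phi> + (1/2) *\<^sub>R \<psi>)"
    by (intro cINF_lower bdd_belowI2[of _ 0] word_energy_nonneg)
  then show ?thesis
    using word_energy_parallelogram[OF assms(6,7), of \<phi> u \<psi>] assms(4,5) by linarith
qed

end

section \<open>Weak-* limits of sequences\<close>

lemma blinfun_convergent_dense:
  fixes \<Phi> :: "nat \<Rightarrow> 'v::real_normed_vector \<Rightarrow>\<^sub>L 'w::banach"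
  assumes dense: "closure (span X) = UNIV" and bound: "\<And>n. norm (\<Phi> n) \<le> 1"
    and conv: "\<And>x. x \<in> X \<Longrightarrow> convergent (\<lambda>n. \<Phi> n x)"
  obtains \<phi> where "\<And>x. (\<lambda>n. \<Phi> n x) \<longlonglongrightarrow> blinfun_apply \<phi> x"
proof -
  have span: "convergent (\<lambda>n. \<Phi> n x)" if "x \<in> span X" for x
    using that
  proof (induction rule: span_induct_alt)
    case (step c x y)
    from conv[OF step.hyps] obtain a where "(\<lambda>n. \<Phi> n x) \<longlonglongrightarrow> a" by (auto simp: convergent_def)
    moreover from step.IH obtain b where "(\<lambda>n. \<Phi> n y) \<longlonglongrightarrow> b" by (auto simp: convergent_def)
    ultimately have "(\<lambda>n. c *\<^sub>R \<Phi> n x + \<Phi> n y) \<longlonglongrightarrow> c *\<^sub>R a + b" by (intro tendsto_intros)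
    then show ?case
      by (auto simp: blinfun.add_right blinfun.scaleR_right convergent_def)
  qed (simp add: convergent_const)
  \<comment> \<open>The norm bound is uniform in \<open>n\<close>, so \<open>x\<close> can be
    replaced by a nearby point of the span at a cost of \<open>e / 3\<close> on either side.\<close>
  have "Cauchy (\<lambda>n. \<Phi> n x)" for x
  proof (rule metric_CauchyI)
    fix e :: real assume "0 < e"
    have "x \<in> closure (span X)" using dense by simp
    then obtain y where y: "y \<in> span X" "dist y x < e / 3"
      using \<open>0 < e\<close> unfolding closure_approachable by (meson divide_pos_pos zero_less_numeral)
    have near: "dist (\<Phi> n x) (\<Phi> n y) < e / 3" for n
    proof -
      have "dist (\<Phi> n x) (\<Phi> n y) = norm (\<Phi> n (x - y))"
        by (simp add: dist_norm blinfun.diff_right)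
      also have "\<dots> \<le> norm (\<Phi> n) * norm (x - y)" by (rule norm_blinfun)
      also have "\<dots> \<le> 1 * norm (x - y)" by (intro mult_right_mono bound) simp
      finally show ?thesis using y(2) by (simp add: dist_norm norm_minus_commute)
    qed
    from span[OF y(1)] have "Cauchy (\<lambda>n. \<Phi> n y)" by (rule convergent_Cauchy)
    then obtain M where M: "\<And>m n. m \<ge> M \<Longrightarrow> n \<ge> M \<Longrightarrow> dist (\<Phi> m y) (\<Phi> n y) < e / 3"
      using \<open>0 < e\<close> unfolding Cauchy_def by (meson divide_pos_pos zero_less_numeral)
    show "\<exists>M. \<forall>m\<ge>M. \<forall>n\<ge>M. dist (\<Phi> m x) (\<Phi> n x) < e"
    proof (intro exI allI impI)
      fix m n assume "M \<le> m" "M \<le> n"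
      then show "dist (\<Phi> m x) (\<Phi> n x) < e"
        using near[of m] near[of n] M[of m n] dist_triangle[of "\<Phi> m x" "\<Phi> n x" "\<Phi> m y"]
          dist_triangle[of "\<Phi> m y" "\<Phi> n x" "\<Phi> n y"]
        unfolding dist_commute[of "\<Phi> n y" "\<Phi> n x"] by linarith
    qed
  qed
  then have lim: "(\<lambda>n. \<Phi> n x) \<longlonglongrightarrow> lim (\<lambda>n. \<Phi> n x)" for x
    using Cauchy_convergent convergent_LIMSEQ_iff by blast
  define g where "g x = lim (\<lambda>n. \<Phi> n x)" for x
  have "bounded_linear g"
  proof (rule bounded_linear_intro)
    show "g (x + y) = g x + g y" for x y
      using tendsto_add[OF lim[of x] lim[of y]] unfolding g_def
      by (intro limI) (simp add: blinfun.add_right)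
    show "g (r *\<^sub>R x) = r *\<^sub>R g x" for r x
      using tendsto_scaleR[OF tendsto_const lim[of x]] unfolding g_def
      by (intro limI) (simp add: blinfun.scaleR_right)
    show "norm (g x) \<le> norm x * 1" for x
    proof (rule tendsto_upperbound)
      show "(\<lambda>n. norm (\<Phi> n x)) \<longlonglongrightarrow> norm (g x)"
        unfolding g_def by (intro tendsto_norm lim)
      have "norm (\<Phi> n x) \<le> norm x * 1" for n
        using order_trans[OF norm_blinfun mult_right_mono[OF bound norm_ge_zero], of n x] by simp
      then show "\<forall>\<^sub>F n in sequentially. norm (\<Phi> n x) \<le> norm x * 1" by simp
    qed simp
  qed
  then show ?thesis
    using that[of "Blinfun g"] lim by (simp add: bounded_linear_Blinfun_apply g_def)
qed

text \<open>The topology is the pullback of the product topology along \<open>blinfun_apply\<close>.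
  Pointwise limits of sequences from a closed set therefore stay in it.\<close>

lemma limitin_strong_operator_topology:
  assumes "\<And>x. (\<lambda>n. blinfun_apply (\<Phi> n) x) \<longlonglongrightarrow> blinfun_apply \<phi> x"
  shows "limitin strong_operator_topology \<Phi> \<phi> sequentially"
  unfolding limitin_def
proof (intro conjI allI impI)
  show "\<phi> \<in> topspace strong_operator_topology"
    by (simp add: strong_operator_topology_topspace)
  fix U assume "openin strong_operator_topology U \<and> \<phi> \<in> U"
  then obtain V where V: "open V" "U = blinfun_apply -` V" "blinfun_apply \<phi> \<in> V"
    by (auto simp: strong_operator_topology_def openin_pullback_topology)
  have "limitin (product_topology (\<lambda>_. euclidean) UNIV) (\<lambda>n. blinfun_apply (\<Phi> n)) (blinfun_apply \<phi>) sequentially"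
    unfolding limitin_componentwise using assms by simp
  then have "(\<lambda>n. blinfun_apply (\<Phi> n)) \<longlonglongrightarrow> blinfun_apply \<phi>"
    by (simp add: euclidean_product_topology)
  then show "\<forall>\<^sub>F n in sequentially. \<Phi> n \<in> U"
    using V by (auto dest: topological_tendstoD)
qed

section \<open>The invariant state of a Pal set\<close>

theorem theorem2p8:
  fixes t :: "'a::cstar_algebra \<Rightarrow> 'a \<Rightarrow> 'b::cstar_algebra"
    and tenl :: "'b \<Rightarrow> 'a \<Rightarrow> 'c::cstar_algebra"
    and tenr :: "'a \<Rightarrow> 'b \<Rightarrow> 'c"
    and \<Delta> :: "'a \<Rightarrow> 'b"
    and N :: nat
    and u :: "nat \<Rightarrow> nat \<Rightarrow> 'a"
    and S :: "('a \<Rightarrow>\<^sub>L complex) set"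
  assumes "quantum_permutation_group t tenl tenr \<Delta> N u"
    and "pal_set t \<Delta> S"
  shows "\<exists>!\<phi>. \<phi> \<in> S \<and>
    (\<forall>\<psi>\<in>S. convolution t \<Delta> \<phi> \<psi> = \<phi> \<and> \<phi> = convolution t \<Delta> \<psi> \<phi>)"
proof -
  interpret quantum_permutation_group t tenl tenr \<Delta> N u by fact
  let ?m = "\<lambda>k. INF \<rho>\<in>S. word_energy N u k \<rho>"
  let ?conv = "convolution t \<Delta>"
  have S_state: "state \<rho>" if "\<rho> \<in> S" for \<rho>
    using assms(2) that by (auto simp: pal_set_def)
  have S_conv: "?conv \<rho> \<rho>' \<in> S" if "\<rho> \<in> S" "\<rho>' \<in> S" for \<rho> \<rho>'
    using assms(2) that by (auto simp: pal_set_def)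
  \<comment> \<open>Stage \<open>n\<close> controls only the finitely many lengths below
    \<open>n\<close>, but each length is covered from some stage on, with error tending to
    0.\<close>
  have "\<forall>n. \<exists>\<phi>\<in>S. \<forall>k<n. word_energy N u k \<phi> \<le> ?m k + inverse (real (Suc n))"
    by (intro allI pal_set_simultaneous_minimiser assms) simp
  then obtain \<Phi> where \<Phi>: "\<And>n. \<Phi> n \<in> S"
    and min: "\<And>n k. k < n \<Longrightarrow> word_energy N u k (\<Phi> n) \<le> ?m k + inverse (real (Suc n))"
    by metis
  have "convergent (\<lambda>n. \<Phi> n x)" if "x \<in> words" for x
  proof -
    from that obtain c I J k where x: "x = c *\<^sub>C word u I J"
      and IJ: "I \<in> multi_indices N k" "J \<in> multi_indices N k"
      unfolding words_def by blast
    have "Cauchy (\<lambda>n. \<Phi> n (word u I J))"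
    proof (rule metric_CauchyI)
      fix e :: real assume "0 < e"
      \<comment> \<open>The quarter compensates the factor 4 in
        \<open>near_minimisers_close\<close>.\<close>
      then have "0 < e\<^sup>2 / 4" by simp
      then obtain M where M: "inverse (real (Suc M)) < e\<^sup>2 / 4"
        using reals_Archimedean by blast
      have min': "word_energy N u k (\<Phi> n) \<le> ?m k + inverse (real (Suc M))" if "n \<ge> max M (Suc k)" for n
      proof -
        have "inverse (real (Suc n)) \<le> inverse (real (Suc M))" "k < n"
          using that by (simp_all add: le_imp_inverse_le)
        then show ?thesis using min[of k n] by linarith
      qed
      show "\<exists>M. \<forall>m\<ge>M. \<forall>n\<ge>M. dist (\<Phi> m (word u I J)) (\<Phi> n (word u I J)) < e"
      proof (intro exI allI impI)
        fix m n assume "m \<ge> max M (Suc k)" "n \<ge> max M (Suc k)"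
        then have *: "(cmod (\<Phi> m (word u I J) - \<Phi> n (word u I J)))\<^sup>2 \<le> 4 * inverse (real (Suc M))"
          by (intro near_minimisers_close[OF assms(2) \<Phi> \<Phi> min' min' IJ])
        have "4 * inverse (real (Suc M)) < e\<^sup>2" using M by simp
        with * have "(cmod (\<Phi> m (word u I J) - \<Phi> n (word u I J)))\<^sup>2 < e\<^sup>2" by (rule le_less_trans)
        then show "dist (\<Phi> m (word u I J)) (\<Phi> n (word u I J)) < e"
          unfolding dist_norm by (rule power2_less_imp_less) (use \<open>0 < e\<close> in simp)
      qed
    qed
    then have "convergent (\<lambda>n. c * \<Phi> n (word u I J))"
      by (intro convergent_mult convergent_const Cauchy_convergent)
    then show ?thesis
      using S_state[OF \<Phi>] by (simp add: x state_def)
  qed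
  then obtain \<phi> where lim: "\<And>x. (\<lambda>n. \<Phi> n x) \<longlonglongrightarrow> blinfun_apply \<phi> x"
    using blinfun_convergent_dense[OF dense_words, of \<Phi>] S_state[OF \<Phi>]
    by (auto simp: state_def)
  have "\<phi> \<in> S"
    using limitin_closedin[OF limitin_strong_operator_topology[OF lim], of S] assms(2) \<Phi>
    by (simp add: pal_set_def)
  \<comment> \<open>Any sequence in \<open>S\<close> dominated in energy by \<open>\<Phi>\<close> is
    again asymptotically minimising, so its entries approach those of \<open>\<Phi>\<close>.
    Convergence on words is enough, since words separate states.\<close>
  have invariant: "\<rho> = \<phi>"
    if C: "\<rho> \<in> S" "\<And>n. X n \<in> S" "\<And>n k. word_energy N u k (X n) \<le> word_energy N u k (\<Phi> n)"
      and Xlim: "\<And>k I J. I \<in> multi_indices N k \<Longrightarrow> J \<in> multi_indices N k \<Longrightarrow>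
        (\<lambda>n. X n (word u I J)) \<longlonglongrightarrow> blinfun_apply \<rho> (word u I J)" for X \<rho>
  proof (rule state_eqI_words)
    fix k I J assume IJ: "I \<in> multi_indices N k" "J \<in> multi_indices N k"
    have "(\<lambda>n. (cmod (X n (word u I J) - \<Phi> n (word u I J)))\<^sup>2)
        \<longlonglongrightarrow> (cmod (\<rho> (word u I J) - \<phi> (word u I J)))\<^sup>2"
      by (intro tendsto_intros Xlim[OF IJ] lim)
    moreover have "(\<lambda>n. 4 * inverse (real (Suc n))) \<longlonglongrightarrow> 4 * 0"
      by (intro tendsto_mult tendsto_const LIMSEQ_inverse_real_of_nat)
    moreover have "(cmod (X n (word u I J) - \<Phi> n (word u I J)))\<^sup>2 \<le> 4 * inverse (real (Suc n))" if "k < n" for n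
      using order_trans[OF C(3) min[OF that]] min[OF that]
      by (intro near_minimisers_close[OF assms(2) C(2) \<Phi> _ _ IJ])
    then have "\<forall>\<^sub>F n in sequentially. (cmod (X n (word u I J) - \<Phi> n (word u I J)))\<^sup>2 \<le> 4 * inverse (real (Suc n))"
      by (intro eventually_sequentiallyI[of "Suc k"]) simp
    ultimately have "(cmod (\<rho> (word u I J) - \<phi> (word u I J)))\<^sup>2 \<le> 4 * 0"
      by (intro tendsto_le[OF sequentially_bot])
    then show "\<rho> (word u I J) = \<phi> (word u I J)" by simp
  qed (use S_state C(1) \<open>\<phi> \<in> S\<close> in auto)
  have "?conv \<phi> \<psi> = \<phi> \<and> \<phi> = ?conv \<psi> \<phi>" if "\<psi> \<in> S" for \<psi>
  proof
    note st = S_state[OF that] S_state[OF \<Phi>] S_state[OF \<open>\<phi> \<in> S\<close>]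
    show "?conv \<phi> \<psi> = \<phi>"
    proof (rule invariant[of _ "\<lambda>n. ?conv (\<Phi> n) \<psi>"])
      fix k I J assume "I \<in> multi_indices N k" "J \<in> multi_indices N k"
      \<comment> \<open>On a word the convolution is a finite sum of products, so the limit may be
        taken in each term.\<close>
      then show "(\<lambda>n. ?conv (\<Phi> n) \<psi> (word u I J)) \<longlonglongrightarrow> ?conv \<phi> \<psi> (word u I J)"
        by (simp add: convolution_word st) (intro tendsto_intros lim)
    qed (intro S_conv word_energy_convolution_le st that \<Phi> \<open>\<phi> \<in> S\<close>)+
    have "?conv \<psi> \<phi> = \<phi>"
    proof (rule invariant[of _ "\<lambda>n. ?conv \<psi> (\<Phi> n)"])
      fix k I J assume "I \<in> multi_indices N k" "J \<in> multi_indices N k"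
      then show "(\<lambda>n. ?conv \<psi> (\<Phi> n) (word u I J)) \<longlonglongrightarrow> ?conv \<psi> \<phi> (word u I J)"
        by (simp add: convolution_word st) (intro tendsto_intros lim)
    qed (intro S_conv word_energy_convolution_le st that \<Phi> \<open>\<phi> \<in> S\<close>)+
    then show "\<phi> = ?conv \<psi> \<phi>" by simp
  qed
  \<comment> \<open>For uniqueness, the convolution of two invariant states equals both of
    them.\<close>
  with \<open>\<phi> \<in> S\<close> show ?thesis
    by (intro ex1I[of _ \<phi>]) (blast, metis)
qed

end
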